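(* Let $\gamma$ be a closed oriented geodesic on an orientable hyperbolic surface, and let $\phi$ be the angle formed by the two outgoing arcs of $\gamma$ at a self-intersection point. Then $$\Pi\left(\frac{l(\gamma)}{2}\right)<\phi<\pi-\Pi\left(\frac{l(\gamma)}{4}\right).$$
   Context: A hyperbolic surface is a surface $M=\mathbb{H}^2/\pi_1(M)$ with $\pi_1(M)$ a discrete torsion-free group of isometries of $\mathbb{H}^2$. $l(\gamma)$ is the length of $\gamma$. A self-intersection point is a point where two arcs of $\gamma$ cross transversely; the two outgoing arcs are the ones leaving the point in the positive directions of the two crossing strands, and $\phi\in(0,\pi)$ is the angle between them. For $a>0$, $\Pi(a)$ is the angle of parallelism: the third angle of a right hyperbolic triangle which has two asymptotically parallel sides and a finite side of length $a$ (one vertex is ideal, the right angle is at one end of the finite side and $\Pi(a)$ is the angle at its other end); equivalently $\Pi(a)=2\arctan(e^{-a})$. *)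

theory Defs
  imports "HOL-Analysis.Analysis" "HOL-Algebra.Group"
begin

section \<open>The hyperbolic plane\<close>

typedef hyp_plane = "{z :: complex. 0 < Im z}" morphisms coord of_coord
  by (rule exI[of _ \<i>]) simp

lemma Im_coord_pos: "0 < Im (coord z)"
  using coord[of z] by simp

lemma ptolemy_half_plane:
  fixes z w u :: complex
  assumes "0 < Im w"
  shows "norm (z - u) * (2 * Im w) \<le> norm (z - w) * norm (w - cnj u) + norm (z - cnj w) * norm (w - u)"
proof -
  have id: "(z - u) * (w - cnj w) = (z - w) * (u - cnj w) + (z - cnj w) * (w - u)"
    by (simp add: algebra_simps)
  have "norm (w - cnj w) = 2 * Im w"
    using assms by (simp add: complex_diff_cnj norm_mult)
  moreover have "norm (u - cnj w) = norm (w - cnj u)"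
    by (metis complex_cnj_cnj complex_cnj_diff complex_mod_cnj norm_minus_commute)
  ultimately show ?thesis
    using norm_triangle_ineq[of "(z - w) * (u - cnj w)" "(z - cnj w) * (w - u)"]
    by (simp add: norm_mult flip: id)
qed

lemma norm_diff_cnj_half_plane:
  fixes z w :: complex
  assumes "0 < Im z" "0 < Im w"
  shows "sqrt ((norm (z - w) / (2 * sqrt (Im z * Im w)))\<^sup>2 + 1) = norm (z - cnj w) / (2 * sqrt (Im z * Im w))"
proof -
  have pos: "0 < Im z * Im w" using assms by simp
  have "(norm (z - cnj w))\<^sup>2 = (norm (z - w))\<^sup>2 + 4 * (Im z * Im w)"
    unfolding cmod_power2 by (simp add: power2_eq_square algebra_simps)
  then have "(norm (z - w) / (2 * sqrt (Im z * Im w)))\<^sup>2 + 1 = (norm (z - cnj w) / (2 * sqrt (Im z * Im w)))\<^sup>2"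
    using pos assms by (simp add: power_divide power_mult_distrib add_divide_distrib)
  then show ?thesis
    using pos by simp
qed

instantiation hyp_plane :: metric_space
begin

text \<open>The distance of the metric \<open>(dx\<^sup>2 + dy\<^sup>2) / y\<^sup>2\<close> on the upper half-plane.\<close>

definition dist_hyp_plane :: "hyp_plane \<Rightarrow> hyp_plane \<Rightarrow> real" where
  "dist_hyp_plane z w =
     2 * arsinh (norm (coord z - coord w) / (2 * sqrt (Im (coord z) * Im (coord w))))"

definition uniformity_hyp_plane :: "(hyp_plane \<times> hyp_plane) filter" where
  "uniformity_hyp_plane = (INF e\<in>{0<..}. principal {(x, y). dist x y < e})"

definition open_hyp_plane :: "hyp_plane set \<Rightarrow> bool" where
  "open_hyp_plane U \<longleftrightarrow> (\<forall>x\<in>U. eventually (\<lambda>(x', y). x' = x \<longrightarrow> y \<in> U) uniformity)"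

instance
proof
  fix x y z :: hyp_plane
  show "(dist x y = 0) = (x = y)"
    using Im_coord_pos[of x] Im_coord_pos[of y]
    by (simp add: dist_hyp_plane_def coord_inject)
  show "dist x y \<le> dist x z + dist y z"
  proof -
    define s where "s = (\<lambda>u v. norm (coord u - coord v) / (2 * sqrt (Im (coord u) * Im (coord v))))"
    define c where "c = (\<lambda>u v. norm (coord u - cnj (coord v)) / (2 * sqrt (Im (coord u) * Im (coord v))))"
    have D: "dist u v = 2 * arsinh (s u v)" for u v
      by (simp add: dist_hyp_plane_def s_def)
    have sym: "s y z = s z y"
      by (simp add: s_def norm_minus_commute mult.commute)
    have C: "cosh (arsinh (s u v)) = c u v" for u v
      using norm_diff_cnj_half_plane[OF Im_coord_pos[of u] Im_coord_pos[of v]]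
      by (simp add: cosh_arsinh_real s_def c_def)
    have pos: "0 < Im (coord x)" "0 < Im (coord y)" "0 < Im (coord z)"
      by (rule Im_coord_pos)+
    have quot: "A / (2 * sqrt (i * k)) * (B / (2 * sqrt (k * j))) + C / (2 * sqrt (i * k)) * (D / (2 * sqrt (k * j)))
        = (A * B + C * D) / ((2 * sqrt (i * j)) * (2 * k))" if "0 < i" "0 < j" "0 < k" for A B C D i j k :: real
    proof -
      have "sqrt (i * k) * sqrt (k * j) = sqrt (i * j) * k"
        using that by (simp add: real_sqrt_mult)
      then have "(2 * sqrt (i * k)) * (2 * sqrt (k * j)) = (2 * sqrt (i * j)) * (2 * k)"
        by (simp add: mult.assoc mult.left_commute)
      then show ?thesis
        by (simp only: times_divide_times_eq add_divide_distrib)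
    qed
    have "s x z * c z y + c x z * s z y
        = (norm (coord x - coord z) * norm (coord z - cnj (coord y))
           + norm (coord x - cnj (coord z)) * norm (coord z - coord y))
          / ((2 * sqrt (Im (coord x) * Im (coord y))) * (2 * Im (coord z)))"
      unfolding s_def c_def by (rule quot) (rule pos)+
    also have "\<dots> \<ge> (norm (coord x - coord y) * (2 * Im (coord z)))
          / ((2 * sqrt (Im (coord x) * Im (coord y))) * (2 * Im (coord z)))"
      using pos ptolemy_half_plane[of "coord z" "coord x" "coord y"]
      by (intro divide_right_mono) auto
    also have "(norm (coord x - coord y) * (2 * Im (coord z)))
          / ((2 * sqrt (Im (coord x) * Im (coord y))) * (2 * Im (coord z))) = s x y"
      using pos by (simp add: s_def)
    finally have "s x y \<le> sinh (arsinh (s x z) + arsinh (s z y))"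
      by (simp add: sinh_add C)
    then have "arsinh (s x y) \<le> arsinh (s x z) + arsinh (s z y)"
      using sinh_real_le_iff[of "arsinh (s x y)" "arsinh (s x z) + arsinh (s z y)"] by simp
    then show ?thesis
      by (simp add: D sym)
  qed
qed (rule uniformity_hyp_plane_def open_hyp_plane_def)+

end


section \<open>Isometries and hyperbolic surfaces\<close>

definition hyp_isometries :: "(hyp_plane \<Rightarrow> hyp_plane) monoid" where
  "hyp_isometries =
     \<lparr>carrier = {f. bij f \<and> (\<forall>x y. dist (f x) (f y) = dist x y)}, mult = (\<circ>), one = id\<rparr>"

lemma group_hyp_isometries: "group hyp_isometries"
proof (rule groupI)
  fix f assume f: "f \<in> carrier hyp_isometries"
  then have "bij (Hilbert_Choice.inv f)"
    by (simp add: hyp_isometries_def bij_imp_bij_inv)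
  moreover have "dist (Hilbert_Choice.inv f x) (Hilbert_Choice.inv f y) = dist x y" for x y
  proof -
    have "dist (f (Hilbert_Choice.inv f x)) (f (Hilbert_Choice.inv f y))
        = dist (Hilbert_Choice.inv f x) (Hilbert_Choice.inv f y)"
      using f by (simp add: hyp_isometries_def)
    then show ?thesis
      using f by (simp add: hyp_isometries_def bij_is_surj surj_f_inv_f)
  qed
  moreover have "Hilbert_Choice.inv f \<circ> f = id"
    using f by (simp add: hyp_isometries_def bij_is_inj)
  ultimately show "\<exists>g\<in>carrier hyp_isometries. g \<otimes>\<^bsub>hyp_isometries\<^esub> f = \<one>\<^bsub>hyp_isometries\<^esub>"
    by (intro bexI[of _ "Hilbert_Choice.inv f"]) (auto simp: hyp_isometries_def)
qed (auto simp: hyp_isometries_def bij_comp o_assoc)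

text \<open>
  \<open>discrete\<close> refers to the product topology on functions, that is to pointwise convergence,
  which on isometries coincides with the compact-open topology.
\<close>

definition hyperbolic_surface_group :: "(hyp_plane \<Rightarrow> hyp_plane) set \<Rightarrow> bool" where
  "hyperbolic_surface_group \<Gamma> \<longleftrightarrow>
     subgroup \<Gamma> hyp_isometries \<and> discrete \<Gamma> \<and>
     (\<forall>g\<in>\<Gamma>. \<forall>n>0. g ^^ n = id \<longrightarrow> g = id)"

definition surface_proj :: "(hyp_plane \<Rightarrow> hyp_plane) set \<Rightarrow> hyp_plane \<Rightarrow> hyp_plane set" where
  "surface_proj \<Gamma> z = (\<lambda>g. g z) ` \<Gamma>"

text \<open>The Jacobian determinant in the half-plane coordinate is positive everywhere.\<close>

definition orientation_preserving :: "(hyp_plane \<Rightarrow> hyp_plane) \<Rightarrow> bool" where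
  "orientation_preserving f \<longleftrightarrow>
     (\<forall>z. \<exists>D. ((\<lambda>w. coord (f (of_coord w))) has_derivative D) (at (coord z)) \<and>
          0 < Re (D 1) * Im (D \<i>) - Im (D 1) * Re (D \<i>))"

definition orientable_surface :: "(hyp_plane \<Rightarrow> hyp_plane) set \<Rightarrow> bool" where
  "orientable_surface \<Gamma> \<longleftrightarrow> (\<forall>g\<in>\<Gamma>. orientation_preserving g)"


section \<open>Geodesics and angles\<close>

text \<open>Geodesic lines are parametrized by arc length and hence oriented.\<close>

definition geodesic_line :: "(real \<Rightarrow> hyp_plane) \<Rightarrow> bool" where
  "geodesic_line c \<longleftrightarrow> (\<forall>s t. dist (c s) (c t) = \<bar>s - t\<bar>)"

definition velocity :: "(real \<Rightarrow> hyp_plane) \<Rightarrow> real \<Rightarrow> complex" where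
  "velocity c t = vector_derivative (\<lambda>u. coord (c u)) (at t)"

text \<open>
  The angle, in \<open>[0, \<pi>]\<close>, between nonzero tangent vectors at a common point. The half-plane
  model is conformal, so that hyperbolic and Euclidean angles agree.
\<close>

definition tangent_angle :: "complex \<Rightarrow> complex \<Rightarrow> real" where
  "tangent_angle v w = arccos (v \<bullet> w / (norm v * norm w))"

definition geodesic_lift ::
  "(hyp_plane \<Rightarrow> hyp_plane) set \<Rightarrow> (real \<Rightarrow> hyp_plane set) \<Rightarrow> (real \<Rightarrow> hyp_plane) \<Rightarrow> bool" where
  "geodesic_lift \<Gamma> \<gamma> c \<longleftrightarrow> geodesic_line c \<and> (\<forall>t. \<gamma> t = surface_proj \<Gamma> (c t))"

text \<open>
  \<open>\<gamma>\<close> is a closed oriented geodesic of length \<open>l\<close>: a unit speed geodesic of \<open>\<H>\<^sup>2 / \<Gamma>\<close> that has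
  \<open>l\<close> as a period. The period need not be the least one, so powers of closed geodesics
  are included.
\<close>

definition closed_geodesic ::
  "(hyp_plane \<Rightarrow> hyp_plane) set \<Rightarrow> (real \<Rightarrow> hyp_plane set) \<Rightarrow> real \<Rightarrow> bool" where
  "closed_geodesic \<Gamma> \<gamma> l \<longleftrightarrow>
     0 < l \<and> (\<exists>c. geodesic_lift \<Gamma> \<gamma> c) \<and> (\<forall>t. \<gamma> (t + l) = \<gamma> t)"

text \<open>
  Two strands of \<open>\<gamma>\<close>, at the parameters \<open>s\<close> and \<open>t\<close>, cross transversely at the point \<open>p\<close> of the
  surface, and their outgoing directions form the angle \<open>\<phi>\<close>. To compare the directions, the
  strands are lifted to geodesic lines through one point of the plane above \<open>p\<close>. The two strands
  are distinct arcs of \<open>\<gamma>\<close> by transversality, as \<open>\<Gamma>\<close> acts freely.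
\<close>

definition self_intersection_angle ::
  "(hyp_plane \<Rightarrow> hyp_plane) set \<Rightarrow> (real \<Rightarrow> hyp_plane set) \<Rightarrow> hyp_plane set \<Rightarrow> real \<Rightarrow> bool" where
  "self_intersection_angle \<Gamma> \<gamma> p \<phi> \<longleftrightarrow>
     (\<exists>c d s t. geodesic_lift \<Gamma> \<gamma> c \<and> geodesic_lift \<Gamma> \<gamma> d \<and>
        c s = d t \<and> p = surface_proj \<Gamma> (c s) \<and>
        \<phi> = tangent_angle (velocity c s) (velocity d t) \<and> 0 < \<phi> \<and> \<phi> < pi)"


section \<open>The angle of parallelism\<close>

text \<open>The rays \<open>t \<ge> 0\<close> of the two lines have the same ideal endpoint.\<close>

definition asymptotic_rays :: "(real \<Rightarrow> hyp_plane) \<Rightarrow> (real \<Rightarrow> hyp_plane) \<Rightarrow> bool" where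
  "asymptotic_rays r u \<longleftrightarrow> (\<exists>B. \<forall>t\<ge>0. dist (r t) (u t) \<le> B)"

text \<open>
  A right triangle with one ideal vertex: the finite side runs along \<open>q\<close> from \<open>q 0\<close>, where the
  angle is right, to \<open>q a\<close>, where the angle is \<open>\<theta>\<close>; the infinite sides are the rays of \<open>r\<close> and \<open>u\<close>.
\<close>

definition right_ideal_triangle :: "real \<Rightarrow> real \<Rightarrow> bool" where
  "right_ideal_triangle a \<theta> \<longleftrightarrow>
     (\<exists>q r u. geodesic_line q \<and> geodesic_line r \<and> geodesic_line u \<and>
        r 0 = q 0 \<and> u 0 = q a \<and> asymptotic_rays r u \<and>
        tangent_angle (velocity q 0) (velocity r 0) = pi / 2 \<and>
        tangent_angle (- velocity q a) (velocity u 0) = \<theta>)"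

text \<open>For \<open>a > 0\<close> such triangles exist and are congruent, so that \<open>\<theta>\<close> is unique.\<close>

definition angle_of_parallelism :: "real \<Rightarrow> real" where
  "angle_of_parallelism a = (THE \<theta>. right_ideal_triangle a \<theta>)"

end

theory Submission
  imports Defs
begin

text \<open>
  At the self-intersection \<open>\<gamma>\<close> decomposes into two loops of lengths \<open>a + b = l\<close>. Put the lift \<open>c\<close>
  on the imaginary axis with the intersection point at \<open>\<i>\<close>. As orientation-preserving isometries are
  Moebius transformations, the deck transformations of the two loops are represented by
  matrices \<open>X\<close> and \<open>Y\<close>, each a translation along the axis times a rotation by \<open>\<phi>\<close> about \<open>\<i>\<close>, such that
  \<open>X Y\<close> is the translation by \<open>l\<close>. Their traces are \<open>2 cos (\<phi>/2) cosh (a/2)\<close>, \<open>2 cos (\<phi>/2) cosh (b/2)\<close>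
  and \<open>2 cosh (l/2)\<close>. A discrete torsion-free group has no elliptic elements, so that all traces have
  absolute value at least \<open>2\<close>. Applied to the shorter loop, this gives
  \<open>cos (\<phi>/2) cosh (l/4) \<ge> 1\<close> and thereby the upper bound.

  For the lower bound, the commutator of \<open>X\<close> and \<open>Y\<close> has trace \<open>2 + 4 (sinh (l/2) sin (\<phi>/2))\<^sup>2 > 2\<close>.
  This trace is invariant under Nielsen moves, and reducing the trace triple of the pair \<open>(X, Y)\<close> by
  such moves ends with traces \<open>x, y \<ge> 2\<close>, \<open>z \<le> -2\<close>, for which
  \<open>x\<^sup>2 + y\<^sup>2 + z\<^sup>2 - x y z - 2 \<ge> 18\<close>. Hence \<open>sinh (l/2) sin (\<phi>/2) \<ge> 2\<close>.
\<close>

section \<open>Moebius transformations\<close>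

lemma hyp_plane_eqI:
  assumes "Re (coord z) = Re (coord w)" "Im (coord z) = Im (coord w)"
  shows "z = w"
  using assms by (metis complex_eqI coord_inject)

lemma coord_of_coord: "0 < Im z \<Longrightarrow> coord (of_coord z) = z"
  by (simp add: of_coord_inverse)

lemma cosh_dist:
  "cosh (dist z w) = 1 + (norm (coord z - coord w))\<^sup>2 / (2 * Im (coord z) * Im (coord w))"
proof -
  have "cosh (2 * x) = 1 + 2 * (sinh x)\<^sup>2" for x :: real
    by (simp add: cosh_double cosh_square_eq)
  then show ?thesis
    using Im_coord_pos[of z] Im_coord_pos[of w]
    by (simp add: dist_hyp_plane_def power_divide power_mult_distrib)
qed

lemma dist_eqI_cosh:
  fixes z w :: "'a :: metric_space"
  assumes "0 \<le> r" "cosh (dist z w) = cosh r"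
  shows "dist z w = r"
  using assms by (metis arcosh_cosh_real zero_le_dist)

text \<open>The automorphy factor: for determinant 1 the derivative of \<open>moebius A\<close> is
  the reciprocal of its square, so it controls imaginary parts, distances and velocities.\<close>

definition moebius_denom :: "real^2^2 \<Rightarrow> hyp_plane \<Rightarrow> complex" where
  "moebius_denom A z = of_real (A$2$1) * coord z + of_real (A$2$2)"

definition moebius :: "real^2^2 \<Rightarrow> hyp_plane \<Rightarrow> hyp_plane" where
  "moebius A z = of_coord ((of_real (A$1$1) * coord z + of_real (A$1$2)) / moebius_denom A z)"

text \<open>The adjugate serves as the inverse for determinant 1. Its entries are linear in those of
  \<open>A\<close>, so trace identities become polynomial.\<close>

definition adj2 :: "real^2^2 \<Rightarrow> real^2^2" where
  "adj2 A = vector [vector [A$2$2, - A$1$2], vector [- A$2$1, A$1$1]]"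

lemma adj2_nth [simp]:
  "adj2 A $ 1 $ 1 = A$2$2" "adj2 A $ 1 $ 2 = - A$1$2" "adj2 A $ 2 $ 1 = - A$2$1" "adj2 A $ 2 $ 2 = A$1$1"
  by (simp_all add: adj2_def)

lemma matrix_mult_nth_2:
  fixes A B :: "real^2^2"
  shows "(A ** B) $ i $ j = A$i$1 * B$1$j + A$i$2 * B$2$j"
  by (simp add: matrix_matrix_mult_def sum_2)

lemma mat_1_nth_2 [simp]:
  "(mat 1 :: real^2^2) $ 1 $ 1 = 1" "(mat 1 :: real^2^2) $ 1 $ 2 = 0"
  "(mat 1 :: real^2^2) $ 2 $ 1 = 0" "(mat 1 :: real^2^2) $ 2 $ 2 = 1"
  by (simp_all add: mat_def)

lemma matrix_eq_2_iff:
  fixes A B :: "real^2^2"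
  shows "A = B \<longleftrightarrow> A$1$1 = B$1$1 \<and> A$1$2 = B$1$2 \<and> A$2$1 = B$2$1 \<and> A$2$2 = B$2$2"
  by (auto simp: vec_eq_iff forall_2)

lemma trace_2: "trace (A :: real^2^2) = A$1$1 + A$2$2"
  by (simp add: trace_def sum_2)

lemma det_adj2 [simp]: "det (adj2 A) = det A"
  by (simp add: det_2)

lemma adj2_mult:
  assumes "det A = 1"
  shows "adj2 A ** A = mat 1" "A ** adj2 A = mat 1"
  using assms by (auto simp: matrix_eq_2_iff matrix_mult_nth_2 det_2 algebra_simps)

text \<open>Cayley-Hamilton: \<open>B + adj2 B\<close> is \<open>trace B\<close> times the identity.
  This is the source of the move from z to x y - z on traces.\<close>

lemma trace_mult_adj2: "trace (A ** adj2 B) = trace A * trace B - trace (A ** B)"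
  by (simp add: trace_2 matrix_mult_nth_2 algebra_simps)

lemma Im_moebius_denom: "Im (moebius_denom A z) = A$2$1 * Im (coord z)"
  and Re_moebius_denom: "Re (moebius_denom A z) = A$2$1 * Re (coord z) + A$2$2"
  by (simp_all add: moebius_denom_def)

lemma moebius_denom_nonzero:
  assumes "det A = 1"
  shows "moebius_denom A z \<noteq> 0"
proof
  assume "moebius_denom A z = 0"
  then have "A$2$1 = 0" "A$2$2 = 0"
    using Im_moebius_denom[of A z] Re_moebius_denom[of A z] Im_coord_pos[of z] by auto
  with assms show False
    by (simp add: det_2)
qed

lemma Im_moebius_formula:
  fixes z :: complex
  shows "Im ((of_real a * z + of_real b) / (of_real c * z + of_real d))
    = (a * d - b * c) * Im z / (norm (of_real c * z + of_real d))\<^sup>2"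
  unfolding Im_divide cmod_power2 by (simp add: algebra_simps)

lemma coord_moebius:
  assumes "det A = 1"
  shows "coord (moebius A z) = (of_real (A$1$1) * coord z + of_real (A$1$2)) / moebius_denom A z"
proof -
  have "Im ((of_real (A$1$1) * coord z + of_real (A$1$2)) / moebius_denom A z)
      = Im (coord z) / (norm (moebius_denom A z))\<^sup>2"
    using assms unfolding moebius_denom_def by (subst Im_moebius_formula) (simp add: det_2)
  then show ?thesis
    using moebius_denom_nonzero[OF assms, of z] Im_coord_pos[of z]
    unfolding moebius_def by (intro coord_of_coord) simp
qed

lemma Im_coord_moebius:
  assumes "det A = 1"
  shows "Im (coord (moebius A z)) = Im (coord z) / (norm (moebius_denom A z))\<^sup>2"
  using assms unfolding coord_moebius[OF assms] moebius_denom_def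
  by (subst Im_moebius_formula) (simp add: det_2)

lemma moebius_denom_mult:
  assumes "det B = 1"
  shows "moebius_denom (A ** B) z = moebius_denom A (moebius B z) * moebius_denom B z"
  using moebius_denom_nonzero[OF assms, of z]
  unfolding moebius_denom_def[of A] coord_moebius[OF assms] moebius_denom_def[of "A ** B"]
  by (simp add: field_simps matrix_mult_nth_2) (simp add: moebius_denom_def algebra_simps)

lemma moebius_mult:
  assumes "det A = 1" "det B = 1"
  shows "moebius (A ** B) z = moebius A (moebius B z)"
proof -
  have AB: "det (A ** B) = 1"
    using assms by (simp add: det_mul)
  have "coord (moebius (A ** B) z) = coord (moebius A (moebius B z))"
    using moebius_denom_nonzero[OF assms(2), of z] moebius_denom_nonzero[OF assms(1), of "moebius B z"]
    unfolding coord_moebius[OF AB] coord_moebius[OF assms(1)] coord_moebius[OF assms(2)]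
      moebius_denom_mult[OF assms(2)]
    by (simp add: field_simps matrix_mult_nth_2) (simp add: moebius_denom_def algebra_simps)
  then show ?thesis
    by (simp add: coord_inject)
qed

lemma moebius_mat_1 [simp]: "moebius (mat 1) z = z"
  by (simp add: moebius_def moebius_denom_def coord_inverse)

text \<open>Because of this ambiguity a sign must be fixed whenever a trace is read off from a
  transformation.\<close>

lemma moebius_minus [simp]: "moebius (- A) z = moebius A z"
proof -
  have "- x / - y = x / y" for x y :: complex by simp
  then have "(- a * u + - b) / (- c * u + - d) = (a * u + b) / (c * u + d)" for a b c d u :: complex
    by (metis add_uminus_conv_diff minus_add_distrib minus_mult_left diff_conv_add_uminus)
  then show ?thesis
    by (simp only: moebius_def moebius_denom_def vector_uminus_component of_real_minus)
qed

lemma det_minus_2 [simp]: "det (- A) = det (A :: real^2^2)"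
  by (simp add: det_2)

lemma trace_minus_2 [simp]: "trace (- A) = - trace (A :: real^2^2)"
  by (simp add: trace_2)

lemma moebius_adj2 [simp]:
  assumes "det A = 1"
  shows "moebius (adj2 A) (moebius A z) = z" "moebius A (moebius (adj2 A) z) = z"
  using assms by (simp_all add: adj2_mult flip: moebius_mult)

text \<open>Cross-multiplication leaves the factor \<open>det A\<close>, which is 1. Together with
  the formula for imaginary parts, the automorphy factors cancel in \<open>cosh_dist\<close>, so
  that distances are preserved.\<close>

lemma moebius_diff:
  assumes "det A = 1"
  shows "coord (moebius A z) - coord (moebius A w)
    = (coord z - coord w) / (moebius_denom A z * moebius_denom A w)"
proof -
  have "of_real (A$1$1) * of_real (A$2$2) - of_real (A$1$2) * of_real (A$2$1) = (1::complex)"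
    using assms by (simp add: det_2 flip: of_real_mult of_real_diff)
  then have "(of_real (A$1$1) * coord z + of_real (A$1$2)) * moebius_denom A w
      - (of_real (A$1$1) * coord w + of_real (A$1$2)) * moebius_denom A z = coord z - coord w"
    unfolding moebius_denom_def by algebra
  then show ?thesis
    using moebius_denom_nonzero[OF assms] unfolding coord_moebius[OF assms]
    by (simp add: diff_frac_eq)
qed

lemma dist_moebius [simp]:
  assumes "det A = 1"
  shows "dist (moebius A z) (moebius A w) = dist z w"
proof -
  have "cosh (dist (moebius A z) (moebius A w)) = cosh (dist z w)"
    using moebius_denom_nonzero[OF assms, of z] moebius_denom_nonzero[OF assms, of w]
      Im_coord_pos[of z] Im_coord_pos[of w]
    unfolding cosh_dist moebius_diff[OF assms] Im_coord_moebius[OF assms]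
    by (simp add: norm_divide norm_mult power_divide power_mult_distrib)
  then show ?thesis
    by (intro dist_eqI_cosh) simp_all
qed

section \<open>Geodesic lines\<close>

text \<open>The imaginary axis with arc-length parameter and \<i> at 0, the model to which all
  geodesic lines are reduced.\<close>

definition vline :: "real \<Rightarrow> hyp_plane" where
  "vline t = of_coord (Complex 0 (exp t))"

lemma coord_vline: "coord (vline t) = Complex 0 (exp t)"
  unfolding vline_def by (rule coord_of_coord) simp

lemma Re_coord_vline [simp]: "Re (coord (vline t)) = 0"
  and Im_coord_vline [simp]: "Im (coord (vline t)) = exp t"
  by (simp_all add: coord_vline)

definition translation :: "real \<Rightarrow> real^2^2" where
  "translation t = vector [vector [exp (t / 2), 0], vector [0, exp (- t / 2)]]"

lemma translation_nth [simp]: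
  "translation t $ 1 $ 1 = exp (t / 2)" "translation t $ 1 $ 2 = 0"
  "translation t $ 2 $ 1 = 0" "translation t $ 2 $ 2 = exp (- t / 2)"
  by (simp_all add: translation_def)

lemma det_translation [simp]: "det (translation t) = 1"
  by (simp add: det_2 flip: exp_add)

lemma moebius_translation_vline: "moebius (translation t) (vline s) = vline (s + t)"
proof (rule hyp_plane_eqI)
  have "exp (t / 2) * (exp s * exp (t / 2)) = exp (s + t)"
    by (simp flip: exp_add)
  then show "Im (coord (moebius (translation t) (vline s))) = Im (coord (vline (s + t)))"
    by (simp add: coord_moebius moebius_denom_def Im_divide_of_real coord_vline exp_minus field_simps)
qed (simp add: coord_moebius moebius_denom_def Re_divide_of_real coord_vline exp_minus)

lemma adj2_translation: "adj2 (translation t) = translation (- t)"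
  by (simp add: matrix_eq_2_iff)

text \<open>The cross terms of the squared norm combine to \<open>1 - det A\<close> and vanish.
  Metric questions about \<i> thus become questions about the sum of the squared entries.\<close>

lemma cosh_dist_vline_moebius:
  assumes "det A = 1"
  shows "cosh (dist (vline 0) (moebius A (vline 0))) = ((A$1$1)\<^sup>2 + (A$1$2)\<^sup>2 + (A$2$1)\<^sup>2 + (A$2$2)\<^sup>2) / 2"
proof -
  let ?n = "(norm (moebius_denom A (vline 0)))\<^sup>2"
  have n: "?n = (A$2$1)\<^sup>2 + (A$2$2)\<^sup>2"
    by (simp add: cmod_power2 Re_moebius_denom Im_moebius_denom)
  have "?n \<noteq> 0"
    using moebius_denom_nonzero[OF assms] by simp
  have "coord (vline 0) - coord (moebius A (vline 0))
      = Complex (- (A$1$2 + A$2$1)) (A$2$2 - A$1$1) / moebius_denom A (vline 0)"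
    using moebius_denom_nonzero[OF assms, of "vline 0"] unfolding coord_moebius[OF assms]
    by (simp add: diff_divide_eq_iff) (simp add: moebius_denom_def complex_eq_iff)
  then have "(norm (coord (vline 0) - coord (moebius A (vline 0))))\<^sup>2
      = ((A$1$2 + A$2$1)\<^sup>2 + (A$2$2 - A$1$1)\<^sup>2) / ?n"
    by (simp add: norm_divide power_divide cmod_power2[of "Complex _ _"])
      (simp add: power2_eq_square algebra_simps)
  then have "cosh (dist (vline 0) (moebius A (vline 0))) = 1 + ((A$1$2 + A$2$1)\<^sup>2 + (A$2$2 - A$1$1)\<^sup>2) / 2"
    using \<open>?n \<noteq> 0\<close> by (simp add: cosh_dist Im_coord_moebius assms)
  also have "\<dots> = ((A$1$1)\<^sup>2 + (A$1$2)\<^sup>2 + (A$2$1)\<^sup>2 + (A$2$2)\<^sup>2 + 2 * (1 - det A)) / 2"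
    by (simp add: det_2 power2_eq_square field_simps)
  finally show ?thesis
    using assms by simp
qed

text \<open>Equality case of the sum-of-squares formula: the sum equals \<open>2 * det A\<close>, so
  two squares add up to 0.\<close>

lemma moebius_fixes_vline_0:
  assumes "det A = 1" "moebius A (vline 0) = vline 0"
  shows "A$2$2 = A$1$1" "A$2$1 = - A$1$2"
proof -
  have "(A$1$1)\<^sup>2 + (A$1$2)\<^sup>2 + (A$2$1)\<^sup>2 + (A$2$2)\<^sup>2 = 2 * det A"
    using cosh_dist_vline_moebius[OF assms(1)] assms by simp
  then have "(A$2$2 - A$1$1)\<^sup>2 + (A$2$1 + A$1$2)\<^sup>2 = 0"
    by (simp add: det_2 power2_eq_square algebra_simps)
  then show "A$2$2 = A$1$1" "A$2$1 = - A$1$2"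
    by (simp_all add: sum_power2_eq_zero_iff eq_neg_iff_add_eq_0)
qed

text \<open>Half-angle convention: the transformation turns tangent vectors at \<i> by
  \<open>2 * \<psi>\<close>.\<close>

definition rotation :: "real \<Rightarrow> real^2^2" where
  "rotation \<psi> = vector [vector [cos \<psi>, sin \<psi>], vector [- sin \<psi>, cos \<psi>]]"

lemma rotation_nth [simp]:
  "rotation \<psi> $ 1 $ 1 = cos \<psi>" "rotation \<psi> $ 1 $ 2 = sin \<psi>"
  "rotation \<psi> $ 2 $ 1 = - sin \<psi>" "rotation \<psi> $ 2 $ 2 = cos \<psi>"
  by (simp_all add: rotation_def)

lemma det_rotation [simp]: "det (rotation \<psi>) = 1"
  by (simp add: det_2 flip: power2_eq_square)

lemma stabilizer_vline_0:
  assumes "det A = 1" "moebius A (vline 0) = vline 0"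
  obtains \<psi> where "A = rotation \<psi>"
proof -
  note A = moebius_fixes_vline_0[OF assms]
  have "(A$1$1)\<^sup>2 + (A$1$2)\<^sup>2 = 1"
    using assms(1) A by (simp add: det_2 power2_eq_square)
  then obtain \<psi> where "A$1$1 = cos \<psi>" "A$1$2 = sin \<psi>"
    by (rule sincos_total_2pi)
  with A have "A = rotation \<psi>"
    by (simp add: matrix_eq_2_iff)
  then show thesis ..
qed

lemma moebius_rotation_vline_0 [simp]: "moebius (rotation \<psi>) (vline 0) = vline 0"
proof -
  have "cosh (dist (vline 0) (moebius (rotation \<psi>) (vline 0))) = cosh 0"
    using sin_cos_squared_add[of \<psi>] by (subst cosh_dist_vline_moebius) simp_all
  then have "dist (vline 0) (moebius (rotation \<psi>) (vline 0)) = 0"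
    by (intro dist_eqI_cosh) simp_all
  then show ?thesis by simp
qed

lemma moebius_transitive: "\<exists>A. det A = 1 \<and> moebius A (vline 0) = z"
proof -
  define y where "y = Im (coord z)"
  define A :: "real^2^2" where
    "A = vector [vector [sqrt y, Re (coord z) / sqrt y], vector [0, 1 / sqrt y]]"
  have y: "0 < y" by (simp add: y_def Im_coord_pos)
  then have det: "det A = 1"
    by (simp add: A_def det_2)
  have "coord (moebius A (vline 0)) = coord z"
    using y unfolding coord_moebius[OF det]
    by (simp add: A_def moebius_denom_def complex_eq_iff Re_divide_of_real Im_divide_of_real
        field_simps y_def flip: of_real_divide)
  with det show ?thesis
    by (auto simp: coord_inject)
qed

lemma dist_vline: "dist (vline s) (vline t) = \<bar>s - t\<bar>"
proof -
  have "cosh (dist (vline 0) (vline t)) = cosh \<bar>t\<bar>" for t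
  proof -
    have "(exp (t / 2))\<^sup>2 = exp t" for t :: real
      by (simp flip: exp_double)
    from this[of t] this[of "- t"] show ?thesis
      using cosh_dist_vline_moebius[of "translation t"]
      by (simp add: moebius_translation_vline cosh_field_def[of t])
  qed
  then have "dist (vline 0) (vline t) = \<bar>t\<bar>" for t
    by (intro dist_eqI_cosh) simp_all
  moreover have "dist (vline s) (vline t) = dist (vline 0) (vline (t - s))"
    using dist_moebius[OF det_translation, of s "vline 0" "vline (t - s)"]
    by (simp add: moebius_translation_vline)
  ultimately show ?thesis by simp
qed

text \<open>A rotation about \<i> brings \<open>w\<close> onto the axis; if it arrives below \<i>, a
  half turn swaps the two halves of the axis.\<close>

lemma rotate_to_vline: "\<exists>\<psi>. moebius (rotation \<psi>) w = vline (dist (vline 0) w)"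
proof -
  define m where "m = (norm (coord w))\<^sup>2 - 1"
  \<comment> \<open>For the matrix \<open>rotation (\<theta> / 2)\<close> this is exactly the
    condition that the image of \<open>w\<close> has real part 0.\<close>
  obtain \<theta> where \<theta>: "2 * Re (coord w) * cos \<theta> = m * sin \<theta>"
  proof (cases "m = 0 \<and> Re (coord w) = 0")
    case False
    define n where "n = sqrt (m\<^sup>2 + (2 * Re (coord w))\<^sup>2)"
    have "m\<^sup>2 + (2 * Re (coord w))\<^sup>2 > 0"
      using False sum_power2_gt_zero_iff[of m "2 * Re (coord w)"] by auto
    then have n: "n > 0" "n\<^sup>2 = m\<^sup>2 + (2 * Re (coord w))\<^sup>2"
      by (simp_all add: n_def)
    then have "(m / n)\<^sup>2 + (2 * Re (coord w) / n)\<^sup>2 = 1"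
      by (simp only: power_divide flip: add_divide_distrib n(2)) simp
    then obtain \<theta> where "m / n = cos \<theta>" "2 * Re (coord w) / n = sin \<theta>"
      by (rule sincos_total_2pi)
    then show thesis
      by (intro that[of \<theta>]) (simp flip: \<open>m / n = cos \<theta>\<close> \<open>2 * Re (coord w) / n = sin \<theta>\<close>)
  qed (use that[of 0] in simp)
  have vertical: "\<exists>t. w' = vline t" if "Re (coord w') = 0" for w'
    using that Im_coord_pos[of w'] by (intro exI[of _ "ln (Im (coord w'))"] hyp_plane_eqI) simp_all
  have "Re (coord (moebius (rotation (\<theta> / 2)) w)) = 0"
  proof -
    have "Re ((of_real (cos (\<theta> / 2)) * coord w + of_real (sin (\<theta> / 2))) * cnj (moebius_denom (rotation (\<theta> / 2)) w))
        = Re (coord w) * ((cos (\<theta> / 2))\<^sup>2 - (sin (\<theta> / 2))\<^sup>2) - sin (\<theta> / 2) * cos (\<theta> / 2) * m"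
      by (simp add: moebius_denom_def m_def cmod_power2) algebra
    also have "\<dots> = 0"
      using \<theta> cos_double[of "\<theta> / 2"] sin_double[of "\<theta> / 2"] by simp
    finally have "Re ((of_real (cos (\<theta> / 2)) * coord w + of_real (sin (\<theta> / 2))) * cnj (moebius_denom (rotation (\<theta> / 2)) w)) = 0" .
    then show ?thesis
      unfolding coord_moebius[OF det_rotation] by (simp add: Re_complex_div_eq_0)
  qed
  then obtain t where t: "moebius (rotation (\<theta> / 2)) w = vline t"
    using vertical by blast
  have dw: "dist (vline 0) w = \<bar>t\<bar>"
    by (metis dist_moebius[OF det_rotation] diff_0 abs_minus_cancel dist_vline moebius_rotation_vline_0 t)
  show ?thesis
  proof (cases "0 \<le> t")
    case True
    with t dw show ?thesis by auto
  next
    case False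
    \<comment> \<open>This matrix acts as z to -1/z.\<close>
    have "moebius (rotation (pi/2)) (vline t) = vline (- t)"
      by (rule hyp_plane_eqI)
        (simp_all add: coord_moebius moebius_denom_def coord_vline Re_divide Im_divide exp_minus
          power2_eq_square field_simps)
    then have "moebius (rotation (pi/2) ** rotation (\<theta>/2)) w = vline (- t)"
      by (simp add: moebius_mult t)
    moreover have "rotation (pi/2) ** rotation (\<theta>/2) = rotation (pi/2 + \<theta>/2)"
      by (simp add: matrix_eq_2_iff matrix_mult_nth_2 cos_add sin_add)
    ultimately show ?thesis
      using False dw by auto
  qed
qed

section \<open>Distances to the imaginary axis and the normal form of geodesic lines\<close>

lemma cosh_dist_vline:
  "2 * exp t * Im (coord w) * cosh (dist (vline t) w)
    = (Re (coord w))\<^sup>2 + (Im (coord w))\<^sup>2 + (exp t)\<^sup>2"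
  using Im_coord_pos[of w] unfolding cosh_dist cmod_power2
  by (simp add: field_simps power2_eq_square)

text \<open>The distance to \<open>vline s\<close> gives an equation whose left side does not
  contain \<open>s\<close>, while its right side is \<open>(exp s)\<^sup>2\<close> times a fixed
  factor. Two values of \<open>s\<close> force that factor to vanish.\<close>

lemma vline_unique:
  assumes "dist (vline a) w = \<bar>a - t\<bar>" "dist (vline b) w = \<bar>b - t\<bar>" "a \<noteq> b"
  shows "w = vline t"
proof -
  define x y where xy: "x = Re (coord w)" "y = Im (coord w)"
  have *: "x\<^sup>2 + y\<^sup>2 - y * exp t = (exp s)\<^sup>2 * (y * exp (- t) - 1)"
    if "dist (vline s) w = \<bar>s - t\<bar>" for s
  proof -
    have "exp s * (exp (s - t) + exp (t - s)) = (exp s)\<^sup>2 * exp (- t) + exp t"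
      by (simp add: distrib_left power2_eq_square flip: exp_add)
    then have "2 * exp s * y * cosh (s - t) = y * ((exp s)\<^sup>2 * exp (- t) + exp t)"
      by (simp add: cosh_field_def)
    moreover have "cosh (dist (vline s) w) = cosh (s - t)"
      using that by simp
    ultimately show ?thesis
      using cosh_dist_vline[of s w] by (simp add: xy algebra_simps)
  qed
  have "((exp a)\<^sup>2 - (exp b)\<^sup>2) * (y * exp (- t) - 1) = 0"
    using trans[OF *[OF assms(1), symmetric] *[OF assms(2)]]
    by (simp only: left_diff_distrib right_minus_eq)
  moreover have "(exp a)\<^sup>2 \<noteq> (exp b)\<^sup>2"
    using assms(3) by simp
  ultimately have "y * exp (- t) = 1"
    by simp
  then have "y = exp t"
    by (simp add: exp_minus field_simps)
  moreover from this have "x = 0"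
    using *[OF assms(1)] \<open>y * exp (- t) = 1\<close> by (simp add: power2_eq_square)
  ultimately show ?thesis
    by (intro hyp_plane_eqI) (simp_all add: xy)
qed

lemma geodesic_line_moebius_iff [simp]:
  "det A = 1 \<Longrightarrow> geodesic_line (\<lambda>t. moebius A (c t)) \<longleftrightarrow> geodesic_line c"
  by (simp add: geodesic_line_def)

lemma geodesic_line_shift: "geodesic_line c \<Longrightarrow> geodesic_line (\<lambda>t. c (t + s))"
  by (simp add: geodesic_line_def)

lemma geodesic_line_vline: "geodesic_line (\<lambda>t. vline (t + s))"
  by (simp add: geodesic_line_def dist_vline)

text \<open>Move \<open>c s\<close> to \<i> and rotate \<open>c (s + 1)\<close> onto the axis; the
  distances to these two points then pin down every other point by
  \<open>vline_unique\<close>.\<close>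

lemma geodesic_line_vlineE:
  assumes "geodesic_line c"
  obtains A where "det A = 1" "\<And>t. c t = moebius A (vline (t - s))"
proof -
  have d: "dist (c u) (c v) = \<bar>u - v\<bar>" for u v
    using assms by (simp add: geodesic_line_def)
  obtain A where A: "det A = 1" "moebius A (vline 0) = c s"
    using moebius_transitive by blast
  define w where "w = moebius (adj2 A) (c (s + 1))"
  have "dist (vline 0) w = dist (c s) (c (s + 1))"
    unfolding w_def using A by (metis det_adj2 dist_moebius moebius_adj2(1))
  then have "dist (vline 0) w = 1"
    by (simp add: d)
  then obtain \<psi> where \<psi>: "moebius (rotation \<psi>) w = vline 1"
    using rotate_to_vline[of w] by auto
  define B where "B = rotation \<psi> ** adj2 A"
  have B: "det B = 1"
    using A by (simp add: B_def det_mul)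
  have B0: "moebius B (c s) = vline 0" and B1: "moebius B (c (s + 1)) = vline 1"
    using A(1) \<psi> by (simp_all add: B_def moebius_mult w_def flip: A(2))
  have "moebius B (c t) = vline (t - s)" for t
  proof (rule vline_unique[of 0 _ _ 1])
    show "dist (vline 0) (moebius B (c t)) = \<bar>0 - (t - s)\<bar>"
      using B d by (simp flip: B0)
    show "dist (vline 1) (moebius B (c t)) = \<bar>1 - (t - s)\<bar>"
      using B d by (simp flip: B1)
  qed simp
  then have "c t = moebius (adj2 B) (vline (t - s))" for t
    using B by (metis moebius_adj2(1))
  with B show thesis
    by (intro that[of "adj2 B"]) simp_all
qed

text \<open>Pull back to the axis, where \<open>vline_unique\<close> applies. This rigidity is what
  makes lifts unique up to the group.\<close>

lemma geodesic_line_eqI: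
  assumes "geodesic_line c" "geodesic_line d" "c s = d s" "c t = d t" "s \<noteq> t"
  shows "c u = d u"
proof -
  obtain A where A: "det A = 1" "\<And>t. c t = moebius A (vline (t - 0))"
    using geodesic_line_vlineE[OF assms(1), where s = 0] by blast
  have "moebius (adj2 A) (d u) = vline u"
  proof (rule vline_unique[OF _ _ assms(5)])
    have "dist (vline v) (moebius (adj2 A) (d u)) = \<bar>v - u\<bar>" if "c v = d v" for v
    proof -
      have "dist (vline v) (moebius (adj2 A) (d u)) = dist (c v) (d u)"
        using A(1) dist_moebius[OF A(1), of "vline v" "moebius (adj2 A) (d u)"] by (simp add: A(2))
      then show ?thesis
        using assms(2) that by (simp add: geodesic_line_def)
    qed
    with assms show "dist (vline s) (moebius (adj2 A) (d u)) = \<bar>s - u\<bar>"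
      "dist (vline t) (moebius (adj2 A) (d u)) = \<bar>t - u\<bar>" by simp_all
  qed
  then have "moebius A (moebius (adj2 A) (d u)) = moebius A (vline u)"
    by simp
  then show ?thesis
    using A by simp
qed

section \<open>Velocities and angles under Moebius transformations\<close>

lemma has_field_derivative_moebius:
  fixes z :: complex and a b c d :: real
  assumes "a * d - b * c = 1" "of_real c * z + of_real d \<noteq> 0"
  shows "((\<lambda>z. (of_real a * z + of_real b) / (of_real c * z + of_real d)) has_field_derivative
    1 / (of_real c * z + of_real d)\<^sup>2) (at z)"
proof -
  have "of_real a * of_real d - of_real b * of_real c = (1::complex)"
    using assms(1) by (simp flip: of_real_mult of_real_diff)
  then have "of_real a * (of_real c * z + of_real d) - (of_real a * z + of_real b) * of_real c = 1"
    by (simp add: algebra_simps)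
  then show ?thesis
    using assms(2) by (auto intro!: derivative_eq_intros simp: power2_eq_square)
qed

lemma has_vector_derivative_moebius:
  assumes "det A = 1" "((\<lambda>u. coord (c u)) has_vector_derivative v) (at t)"
  shows "((\<lambda>u. coord (moebius A (c u))) has_vector_derivative v / (moebius_denom A (c t))\<^sup>2) (at t)"
proof -
  have "((\<lambda>z. (of_real (A$1$1) * z + of_real (A$1$2)) / (of_real (A$2$1) * z + of_real (A$2$2)))
      has_field_derivative 1 / (moebius_denom A (c t))\<^sup>2) (at (coord (c t)))"
    using assms(1) moebius_denom_nonzero[OF assms(1), of "c t"]
    unfolding moebius_denom_def by (intro has_field_derivative_moebius) (simp_all add: det_2)
  from field_vector_diff_chain_at[OF assms(2) this] show ?thesis
    by (simp add: coord_moebius[OF assms(1)] moebius_denom_def o_def)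
qed

lemma has_vector_derivative_vline:
  "((\<lambda>u. coord (vline (u - s))) has_vector_derivative \<i> * exp (t - s)) (at t)"
proof -
  have "((\<lambda>u. \<i> * complex_of_real (exp (u - s))) has_vector_derivative \<i> * exp (t - s)) (at t)"
    by (auto intro!: derivative_eq_intros)
  moreover have "coord (vline u) = \<i> * complex_of_real (exp u)" for u
    by (simp add: coord_vline complex_eq_iff)
  ultimately show ?thesis by simp
qed

lemma velocity_moebius_vline:
  assumes "det A = 1"
  shows "velocity (\<lambda>t. moebius A (vline (t - s))) t
    = \<i> * exp (t - s) / (moebius_denom A (vline (t - s)))\<^sup>2"
  unfolding velocity_def
  by (intro vector_derivative_at has_vector_derivative_moebius assms has_vector_derivative_vline)

text \<open>Being a geodesic line supplies the differentiability without which
  \<open>vector_derivative\<close> carries no information.\<close>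

lemma velocity_moebius:
  assumes "det A = 1" "geodesic_line c"
  shows "velocity (\<lambda>t. moebius A (c t)) t = velocity c t / (moebius_denom A (c t))\<^sup>2"
proof -
  obtain B where B: "det B = 1" "\<And>t. c t = moebius B (vline (t - 0))"
    using geodesic_line_vlineE[OF assms(2), where s = 0] by blast
  have "((\<lambda>u. coord (c u)) has_vector_derivative \<i> * exp (t - 0) / (moebius_denom B (vline (t - 0)))\<^sup>2) (at t)"
    unfolding B(2) by (intro has_vector_derivative_moebius B has_vector_derivative_vline)
  then have "((\<lambda>u. coord (c u)) has_vector_derivative velocity c t) (at t)"
    by (simp add: velocity_def vector_derivative_at)
  from has_vector_derivative_moebius[OF assms(1) this] show ?thesis
    by (simp add: velocity_def vector_derivative_at)
qed

text \<open>Multiplication by a nonzero complex number is a similarity; this is where conformality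
  enters.\<close>

lemma tangent_angle_mult:
  assumes "k \<noteq> 0"
  shows "tangent_angle (k * v) (k * w) = tangent_angle v w"
proof -
  have "(k * v) \<bullet> (k * w) = (norm k)\<^sup>2 * (v \<bullet> w)"
    unfolding cmod_power2 by (simp add: inner_complex_def power2_eq_square algebra_simps)
  then show ?thesis
    using assms by (simp add: tangent_angle_def norm_mult power2_eq_square)
qed

text \<open>Both velocities get the same complex factor since the lines meet at a common point. The
  version with a minus sign is for a side traversed backwards, as in
  \<open>right_ideal_triangle\<close>.\<close>

lemma tangent_angle_moebius:
  assumes "det A = 1" "geodesic_line c" "geodesic_line d" "c s = d t"
  shows "tangent_angle (velocity (\<lambda>t. moebius A (c t)) s) (velocity (\<lambda>t. moebius A (d t)) t)
      = tangent_angle (velocity c s) (velocity d t)"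
    and "tangent_angle (- velocity (\<lambda>t. moebius A (c t)) s) (velocity (\<lambda>t. moebius A (d t)) t)
      = tangent_angle (- velocity c s) (velocity d t)"
proof -
  let ?k = "1 / (moebius_denom A (d t))\<^sup>2"
  have "?k \<noteq> 0"
    using moebius_denom_nonzero[OF assms(1)] by simp
  from tangent_angle_mult[OF this, of "velocity c s" "velocity d t"]
    tangent_angle_mult[OF this, of "- velocity c s" "velocity d t"]
  show "tangent_angle (velocity (\<lambda>t. moebius A (c t)) s) (velocity (\<lambda>t. moebius A (d t)) t)
      = tangent_angle (velocity c s) (velocity d t)"
    and "tangent_angle (- velocity (\<lambda>t. moebius A (c t)) s) (velocity (\<lambda>t. moebius A (d t)) t)
      = tangent_angle (- velocity c s) (velocity d t)"
    using assms by (simp_all add: velocity_moebius)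
qed

section \<open>Orientation-preserving isometries\<close>

text \<open>Distances to two points of the axis determine the imaginary part and the square of the
  real part, so each point is fixed or reflected. Preserving the distances between points off the
  axis makes the choice uniform.\<close>

lemma isometry_fixing_vline:
  assumes iso: "\<And>z w. dist (g z) (g w) = dist z w" and fixes_vline: "\<And>t. g (vline t) = vline t"
  shows "(\<forall>w. g w = w) \<or> (\<forall>w. coord (g w) = - cnj (coord w))"
proof -
  define x y where "x w = Re (coord w)" and "y w = Im (coord w)" for w
  have y: "0 < y w" for w
    by (simp add: y_def Im_coord_pos)
  have *: "y (g w) = y w \<and> (x (g w))\<^sup>2 = (x w)\<^sup>2" for w
  proof -
    define D where "D t = cosh (dist (vline t) w)" for t
    have D: "2 * exp t * y u * D t = (x u)\<^sup>2 + (y u)\<^sup>2 + (exp t)\<^sup>2"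
      if "u = w \<or> u = g w" for t u
    proof -
      have "dist (vline t) (g w) = dist (vline t) w"
        using iso[of "vline t" w] by (simp add: fixes_vline)
      with that show ?thesis
        using cosh_dist_vline[of t u] by (auto simp: x_def y_def D_def)
    qed
    \<comment> \<open>Difference of the equations for \<open>t = 1\<close> and \<open>t = 0\<close>,
      which eliminates the sum of squares and leaves \<open>y u\<close> as the only unknown.\<close>
    define K where "K = 2 * exp 1 * D 1 - 2 * D 0"
    have K: "y u * K = (exp 1)\<^sup>2 - 1" if "u = w \<or> u = g w" for u
      using D[OF that, of 0] D[OF that, of 1] by (simp add: K_def algebra_simps)
    have "y (g w) * K = y w * K"
      using K[of w] K[of "g w"] by simp
    moreover have "K \<noteq> 0"
    proof -
      have "(exp 1)\<^sup>2 > (1 :: real)"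
        by (simp add: power2_eq_square flip: exp_add)
      moreover have "y w * K = (exp 1)\<^sup>2 - 1"
        by (intro K) simp
      ultimately show ?thesis by (metis less_irrefl mult_zero_right right_minus_eq)
    qed
    ultimately have "y (g w) = y w"
      by simp
    then show ?thesis
      using D[of w 0] D[of "g w" 0] by simp
  qed
  have sym: "x u * x v = 0" if "x (g u) = x u" "x (g v) = - x v" for u v
  proof -
    have "cosh (dist (g u) (g v)) = cosh (dist u v)"
      by (simp add: iso)
    then have "(x u - x v)\<^sup>2 = (x u + x v)\<^sup>2"
      using * that y[of u] y[of v] unfolding cosh_dist cmod_power2
      by (simp add: field_simps flip: x_def y_def)
    then show ?thesis
      by (simp add: power2_eq_square algebra_simps)
  qed
  have cases: "x (g w) = x w \<or> x (g w) = - x w" for w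
    using * by (simp add: power2_eq_iff)
  have "(\<forall>w. x (g w) = x w) \<or> (\<forall>w. x (g w) = - x w)"
  proof (rule ccontr)
    assume "\<not> ?thesis"
    then obtain u v where "x (g u) \<noteq> x u" "x (g v) \<noteq> - x v" by blast
    with cases[of u] cases[of v] sym[of v u] show False by auto
  qed
  then show ?thesis
    using * by (auto simp: complex_eq_iff x_def y_def intro!: hyp_plane_eqI)
qed

text \<open>After composition with the inverse of a Moebius transformation the isometry fixes the
  axis, so it is the identity or the reflection. The reflection is excluded by its negative Jacobian
  at \<i>.\<close>

lemma orientation_preserving_isometry_moebius:
  assumes "f \<in> carrier hyp_isometries" "orientation_preserving f"
  obtains A where "det A = 1" "f = moebius A"
proof -
  have iso: "dist (f z) (f w) = dist z w" for z w
    using assms(1) by (simp add: hyp_isometries_def)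
  have "geodesic_line (\<lambda>t. f (vline t))"
    by (simp add: geodesic_line_def iso dist_vline)
  from geodesic_line_vlineE[OF this, where s = 0]
  obtain A where A: "det A = 1" "\<And>t. f (vline t) = moebius A (vline (t - 0))"
    by blast
  define g where "g w = moebius (adj2 A) (f w)" for w
  have f_eq: "f w = moebius A (g w)" for w
    using A(1) by (simp add: g_def)
  have "(\<forall>w. g w = w) \<or> (\<forall>w. coord (g w) = - cnj (coord w))"
    using A by (intro isometry_fixing_vline) (simp_all add: g_def iso)
  then show thesis
  proof
    assume "\<forall>w. g w = w"
    then have "f = moebius A"
      using f_eq by auto
    with A(1) show thesis ..
  next
    assume g: "\<forall>w. coord (g w) = - cnj (coord w)"
    define F where "F z = (of_real (A$1$1) * z + of_real (A$1$2)) / (of_real (A$2$1) * z + of_real (A$2$2))"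
      for z :: complex
    define m where "m = 1 / (of_real (A$2$1) * \<i> + of_real (A$2$2))\<^sup>2"
    have nz: "of_real (A$2$1) * \<i> + of_real (A$2$2) \<noteq> (0::complex)"
      using A(1) by (auto simp: complex_eq_iff det_2)
    have "(F has_field_derivative m) (at (- cnj \<i>))"
      unfolding F_def[abs_def] m_def using A(1) nz
      by (simp, intro has_field_derivative_moebius) (simp_all add: det_2)
    then have "(F has_derivative (*) m) (at (- cnj \<i>))"
      by (rule has_field_derivative_imp_has_derivative)
    moreover have "((\<lambda>w. - cnj w) has_derivative (\<lambda>h. - cnj h)) (at \<i>)"
      by (auto intro!: derivative_eq_intros bounded_linear.has_derivative[OF bounded_linear_cnj])
    ultimately have "((\<lambda>w. F (- cnj w)) has_derivative (\<lambda>h. m * - cnj h)) (at \<i>)"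
      by (intro has_derivative_compose[of "\<lambda>w. - cnj w" _ _ _ F])
    then have F': "((\<lambda>w. coord (f (of_coord w))) has_derivative (\<lambda>h. m * - cnj h)) (at \<i>)"
    proof (rule has_derivative_transform_within_open[where s = "{z. 0 < Im z}"])
      fix z :: complex assume "z \<in> {z. 0 < Im z}"
      then show "F (- cnj z) = coord (f (of_coord z))"
        using A(1) g by (simp add: f_eq coord_moebius moebius_denom_def F_def coord_of_coord)
    qed (simp_all add: open_halfspace_Im_gt)
    have "coord (vline 0) = \<i>"
      by (simp add: coord_vline complex_eq_iff)
    then obtain D where "((\<lambda>w. coord (f (of_coord w))) has_derivative D) (at \<i>)"
      and D: "0 < Re (D 1) * Im (D \<i>) - Im (D 1) * Re (D \<i>)"
      using assms(2) unfolding orientation_preserving_def by metis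
    then have "D = (\<lambda>h. m * - cnj h)"
      using F' has_derivative_unique by blast
    then have "Re (D 1) * Im (D \<i>) - Im (D 1) * Re (D \<i>) = - ((Re m)\<^sup>2 + (Im m)\<^sup>2)"
      by (simp add: power2_eq_square)
    with D show thesis
      by (smt (verit) zero_le_power2)
  qed
qed

section \<open>The angle of parallelism\<close>

lemma asymptotic_rays_moebius_iff [simp]:
  "det A = 1 \<Longrightarrow> asymptotic_rays (\<lambda>t. moebius A (r t)) (\<lambda>t. moebius A (u t)) \<longleftrightarrow> asymptotic_rays r u"
  by (simp add: asymptotic_rays_def)

text \<open>Conjugation by \<open>translation t\<close> carries \<open>vline t\<close> back to \<i>
  and scales the off-diagonal entries.\<close>

lemma cosh_dist_vline_moebius_vline:
  assumes "det W = 1"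
  shows "cosh (dist (vline t) (moebius W (vline t)))
    = ((W$1$1)\<^sup>2 + (exp (- t) * W$1$2)\<^sup>2 + (exp t * W$2$1)\<^sup>2 + (W$2$2)\<^sup>2) / 2"
proof -
  define V where "V = translation (- t) ** W ** translation t"
  have V: "det V = 1"
    using assms by (simp add: V_def det_mul)
  have "exp (t / 2) * exp (t / 2) = exp t" "exp (- (t / 2)) * exp (- (t / 2)) = exp (- t)"
    by (simp_all flip: exp_add)
  then have V_nth: "V$1$1 = W$1$1" "V$1$2 = exp (- t) * W$1$2" "V$2$1 = exp t * W$2$1" "V$2$2 = W$2$2"
    by (simp_all add: V_def matrix_mult_nth_2 mult.left_commute mult.assoc flip: exp_add)
  have "moebius V (vline 0) = moebius (translation (- t)) (moebius W (vline t))"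
    using assms by (simp add: V_def moebius_mult det_mul moebius_translation_vline)
  moreover have "vline 0 = moebius (translation (- t)) (vline t)"
    by (simp add: moebius_translation_vline)
  ultimately have "dist (vline 0) (moebius V (vline 0)) = dist (vline t) (moebius W (vline t))"
    by (simp del: moebius_translation_vline)
  then show ?thesis
    using cosh_dist_vline_moebius[OF V] by (simp add: V_nth)
qed

text \<open>The ray \<open>vline\<close> ends at infinity, and the lower left entry vanishes exactly
  when \<open>W\<close> fixes infinity. It is the entry whose contribution to the distance grows
  with \<open>t\<close>.\<close>

lemma asymptotic_rays_vline_iff:
  assumes "det W = 1"
  shows "asymptotic_rays vline (\<lambda>t. moebius W (vline t)) \<longleftrightarrow> W$2$1 = 0"
proof
  assume "asymptotic_rays vline (\<lambda>t. moebius W (vline t))"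
  then obtain B where B: "dist (vline t) (moebius W (vline t)) \<le> B" if "0 \<le> t" for t
    by (auto simp: asymptotic_rays_def)
  show "W$2$1 = 0"
  proof (rule ccontr)
    assume nz: "W$2$1 \<noteq> 0"
    \<comment> \<open>Chosen such that the distance bound \<open>B\<close> at this \<open>t\<close>
      would give \<open>(exp t)\<^sup>2 \<le> 2 * t\<close>.\<close>
    define t where "t = cosh B / (W$2$1)\<^sup>2"
    have t: "0 \<le> t"
      by (simp add: t_def)
    have "(exp t * W$2$1)\<^sup>2 / 2 \<le> cosh (dist (vline t) (moebius W (vline t)))"
      unfolding cosh_dist_vline_moebius_vline[OF assms] by (intro divide_right_mono) auto
    also have "\<dots> \<le> cosh B"
      using B[OF t] zero_le_dist order_trans by (subst cosh_real_nonneg_le_iff) blast+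
    also have "\<dots> = t * (W$2$1)\<^sup>2"
      using nz by (simp add: t_def)
    finally have "(exp t)\<^sup>2 * (W$2$1)\<^sup>2 \<le> (2 * t) * (W$2$1)\<^sup>2"
      by (simp add: power_mult_distrib)
    then have "(exp t)\<^sup>2 \<le> 2 * t"
      using nz by simp
    moreover have "1 + 2 * t \<le> (exp t)\<^sup>2"
      using exp_ge_add_one_self[of "2 * t"] by (simp add: exp_double)
    ultimately show False by simp
  qed
next
  assume W: "W$2$1 = 0"
  \<comment> \<open>\<open>K\<close> bounds twice the hyperbolic cosine of the distance, which in
    turn exceeds the distance itself.\<close>
  define K where "K = (W$1$1)\<^sup>2 + (W$1$2)\<^sup>2 + (W$2$2)\<^sup>2"
  have "dist (vline t) (moebius W (vline t)) \<le> K" if "0 \<le> t" for t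
  proof -
    let ?d = "dist (vline t) (moebius W (vline t))"
    have "(exp (- t))\<^sup>2 * (W$1$2)\<^sup>2 \<le> 1\<^sup>2 * (W$1$2)\<^sup>2"
      using that by (intro mult_right_mono power_mono) auto
    then have "2 * cosh ?d \<le> K"
      unfolding cosh_dist_vline_moebius_vline[OF assms] K_def by (simp add: W power_mult_distrib)
    moreover have "0 < exp (- ?d)"
      by simp
    ultimately show ?thesis
      using exp_ge_add_one_self[of ?d] unfolding cosh_field_def by argo
  qed
  then show "asymptotic_rays vline (\<lambda>t. moebius W (vline t))"
    by (auto simp: asymptotic_rays_def)
qed

lemma velocity_moebius_rotation_vline:
  "velocity (\<lambda>t. moebius (rotation \<psi>) (vline (t - s))) s = \<i> * cis (2 * \<psi>)"
proof -
  have "moebius_denom (rotation \<psi>) (vline 0) = cis (- \<psi>)"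
    by (simp add: moebius_denom_def coord_vline complex_eq_iff)
  then have "1 / (moebius_denom (rotation \<psi>) (vline 0))\<^sup>2 = cis (2 * \<psi>)"
    by (simp add: power2_eq_square cis_mult cis_divide flip: cis_zero)
  then show ?thesis
    by (simp add: velocity_moebius_vline divide_inverse)
qed

lemma velocity_vline: "velocity (\<lambda>t. vline (t - s)) s = \<i>"
  using velocity_moebius_vline[of "mat 1" s s] by (simp add: moebius_denom_def det_I)

lemma tangent_angle_cis:
  "tangent_angle \<i> (\<i> * cis \<alpha>) = arccos (cos \<alpha>)"
  "tangent_angle (- \<i>) (\<i> * cis \<alpha>) = arccos (- cos \<alpha>)"
  by (simp_all add: tangent_angle_def norm_mult inner_complex_def)

text \<open>Pull back by \<open>translation a\<close> to compare directions at \<i>. The shifts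
  \<open>t - 0\<close> match the shape \<open>t - s\<close> in the velocity lemmas.\<close>

lemma tangent_angle_translation_rotation:
  "tangent_angle (- velocity (\<lambda>t. vline (t - 0)) a)
      (velocity (\<lambda>t. moebius (translation a) (moebius (rotation \<sigma>) (vline (t - 0)))) 0)
    = arccos (- cos (2 * \<sigma>))"
proof -
  let ?q = "\<lambda>t. vline (t - a)" and ?u = "\<lambda>t. moebius (rotation \<sigma>) (vline (t - 0))"
  have q: "(\<lambda>t. vline (t - 0)) = (\<lambda>t. moebius (translation a) (?q t))"
    by (simp add: moebius_translation_vline)
  have lines: "geodesic_line ?q" "geodesic_line ?u"
    using geodesic_line_vline[of "- a"] geodesic_line_vline[of 0] by simp_all
  have "tangent_angle (- velocity (\<lambda>t. moebius (translation a) (?q t)) a)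
      (velocity (\<lambda>t. moebius (translation a) (?u t)) 0) = tangent_angle (- velocity ?q a) (velocity ?u 0)"
    by (rule tangent_angle_moebius(2)[OF det_translation lines]) simp
  also have "\<dots> = arccos (- cos (2 * \<sigma>))"
    by (simp only: velocity_vline velocity_moebius_rotation_vline tangent_angle_cis)
  finally show ?thesis
    unfolding q .
qed

lemma geodesic_line_rotationE:
  assumes "geodesic_line c" "c s = vline 0"
  obtains \<psi> where "\<And>t. c t = moebius (rotation \<psi>) (vline (t - s))"
proof -
  obtain A where A: "det A = 1" "\<And>t. c t = moebius A (vline (t - s))"
    using geodesic_line_vlineE[OF assms(1)] by blast
  then have "moebius A (vline 0) = vline 0"
    using assms(2) by (metis diff_self)
  with A(1) obtain \<psi> where "A = rotation \<psi>"
    by (rule stabilizer_vline_0)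
  with A(2) show thesis
    by (intro that) simp
qed

text \<open>Bring the first ray to \<open>vline\<close>: the condition is that the lower left entry
  of \<open>W\<close>, written out, is 0.\<close>

lemma asymptotic_rays_normal_form:
  "asymptotic_rays (\<lambda>t. moebius (rotation \<rho>) (vline t))
      (\<lambda>t. moebius (translation a) (moebius (rotation \<sigma>) (vline t)))
    \<longleftrightarrow> exp (a / 2) * sin \<rho> * cos \<sigma> = exp (- a / 2) * cos \<rho> * sin \<sigma>" (is "asymptotic_rays ?r ?u \<longleftrightarrow> _")
proof -
  define W where "W = adj2 (rotation \<rho>) ** (translation a ** rotation \<sigma>)"
  have W: "det W = 1"
    by (simp add: W_def det_mul)
  have "?u = (\<lambda>t. moebius (rotation \<rho>) (moebius W (vline t)))"
    by (simp add: W_def moebius_mult det_mul)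
  then have "asymptotic_rays ?r ?u \<longleftrightarrow> asymptotic_rays vline (\<lambda>t. moebius W (vline t))"
    by simp
  also have "\<dots> \<longleftrightarrow> W$2$1 = 0"
    by (rule asymptotic_rays_vline_iff[OF W])
  also have "\<dots> \<longleftrightarrow> exp (a / 2) * sin \<rho> * cos \<sigma> = exp (- a / 2) * cos \<rho> * sin \<sigma>"
    by (auto simp: W_def matrix_mult_nth_2 algebra_simps)
  finally show ?thesis .
qed

lemma cos_double_arctan: "cos (2 * arctan x) = (1 - x\<^sup>2) / (1 + x\<^sup>2)"
proof -
  have "1 + x\<^sup>2 > 0"
    by (simp add: add_pos_nonneg)
  moreover have "(cos (arctan x))\<^sup>2 = 1 / (1 + x\<^sup>2)"
    using \<open>1 + x\<^sup>2 > 0\<close> by (simp add: cos_arctan power_divide)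
  ultimately show ?thesis
    unfolding cos_double_cos by (simp add: field_simps)
qed

text \<open>The hypothesis says that the squared tangent of \<open>\<sigma>\<close> is
  \<open>exp (2 * a)\<close>. With \<open>x = exp (- a)\<close> the argument of
  \<open>arccos\<close> becomes (1 - x^2) / (1 + x^2), the cosine of twice the arctangent of
  x.\<close>

lemma arccos_cos_double_arctan_exp:
  assumes "exp a * (cos \<sigma>)\<^sup>2 = exp (- a) * (sin \<sigma>)\<^sup>2"
  shows "arccos (- cos (2 * \<sigma>)) = 2 * arctan (exp (- a))"
proof -
  define x where "x = exp (- a)"
  have x: "0 < x" "x * exp a = 1"
    by (simp_all add: x_def flip: exp_add)
  have "x * exp a * (cos \<sigma>)\<^sup>2 = x * x * (sin \<sigma>)\<^sup>2"
    using assms by (simp add: x_def mult.assoc)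
  then have c: "(cos \<sigma>)\<^sup>2 = x\<^sup>2 * (sin \<sigma>)\<^sup>2"
    by (simp add: x power2_eq_square)
  then have "(sin \<sigma>)\<^sup>2 * (1 + x\<^sup>2) = 1"
    using sin_cos_squared_add[of \<sigma>] by (simp add: algebra_simps)
  moreover have "1 + x\<^sup>2 > 0"
    by (simp add: add_pos_nonneg)
  ultimately have s: "(sin \<sigma>)\<^sup>2 = 1 / (1 + x\<^sup>2)"
    by (simp add: field_simps)
  have "- cos (2 * \<sigma>) = (1 - x\<^sup>2) * (sin \<sigma>)\<^sup>2"
    unfolding cos_double c by (simp add: algebra_simps)
  also have "\<dots> = cos (2 * arctan x)"
    by (simp add: s cos_double_arctan)
  finally have "arccos (- cos (2 * \<sigma>)) = arccos (cos (2 * arctan x))"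
    by simp
  also have "\<dots> = 2 * arctan x"
    using x arctan_ubound[of x] by (intro arccos_cos) auto
  finally show ?thesis
    by (simp add: x_def)
qed

text \<open>Normalise \<open>q\<close> to the axis, so that \<open>r\<close> and \<open>u\<close>
  are given by rotation parameters. The right angle gives the first one equal squares of sine and
  cosine, and asymptoticity then determines the tangent of the second up to sign.\<close>

lemma right_ideal_triangle_iff: "right_ideal_triangle a \<theta> \<longleftrightarrow> \<theta> = 2 * arctan (exp (- a))"
proof
  assume "right_ideal_triangle a \<theta>"
  then obtain q r u where lines: "geodesic_line q" "geodesic_line r" "geodesic_line u"
    and start: "r 0 = q 0" "u 0 = q a" and asym: "asymptotic_rays r u"
    and right_angle: "tangent_angle (velocity q 0) (velocity r 0) = pi / 2"
    and \<theta>: "tangent_angle (- velocity q a) (velocity u 0) = \<theta>"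
    by (auto simp: right_ideal_triangle_def)
  obtain Q where Q: "det Q = 1" "\<And>t. q t = moebius Q (vline (t - 0))"
    using geodesic_line_vlineE[OF lines(1), where s = 0] by blast
  have "q a = moebius Q (moebius (translation a) (vline 0))"
    by (simp add: Q(2) moebius_translation_vline)
  with start Q have base: "moebius (adj2 Q) (r 0) = vline 0"
    "moebius (translation (- a)) (moebius (adj2 Q) (u 0)) = vline 0"
    by (simp_all flip: adj2_translation)
  obtain \<rho> where \<rho>: "\<And>t. moebius (adj2 Q) (r t) = moebius (rotation \<rho>) (vline (t - 0))"
    using geodesic_line_rotationE[of "\<lambda>t. moebius (adj2 Q) (r t)" 0] base(1) lines Q(1) by auto
  obtain \<sigma> where \<sigma>: "\<And>t. moebius (translation (- a)) (moebius (adj2 Q) (u t)) = moebius (rotation \<sigma>) (vline (t - 0))"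
    using geodesic_line_rotationE[of "\<lambda>t. moebius (translation (- a)) (moebius (adj2 Q) (u t))" 0]
      base(2) lines Q(1) by auto
  have r: "r = (\<lambda>t. moebius Q (moebius (rotation \<rho>) (vline (t - 0))))"
    unfolding \<rho>[symmetric] using Q(1) by simp
  have u: "u = (\<lambda>t. moebius Q (moebius (translation a) (moebius (rotation \<sigma>) (vline (t - 0)))))"
    unfolding \<sigma>[symmetric] using Q(1) by (simp flip: adj2_translation)
  have q: "q = (\<lambda>t. moebius Q (vline (t - 0)))"
    using Q(2) by auto
  have "tangent_angle (velocity q 0) (velocity r 0) = arccos (cos (2 * \<rho>))"
    unfolding q r using geodesic_line_vline[of 0]
    by (subst tangent_angle_moebius[OF Q(1)])
      (simp_all only: velocity_vline velocity_moebius_rotation_vline tangent_angle_cis, simp_all)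
  then have "cos (2 * \<rho>) = 0"
    using right_angle by (metis cos_arccos abs_cos_le_one abs_le_iff cos_pi_half minus_le_iff)
  then have "(sin \<rho>)\<^sup>2 = (cos \<rho>)\<^sup>2"
    by (simp add: cos_double)
  moreover have "(sin \<rho>)\<^sup>2 + (cos \<rho>)\<^sup>2 = 1"
    by simp
  ultimately have \<rho>2: "(sin \<rho>)\<^sup>2 = 1 / 2" "(cos \<rho>)\<^sup>2 = 1 / 2"
    by linarith+
  have "exp (a / 2) * sin \<rho> * cos \<sigma> = exp (- a / 2) * cos \<rho> * sin \<sigma>"
    using asym Q(1) unfolding r u by (simp add: asymptotic_rays_normal_form)
  \<comment> \<open>Squaring removes the sign ambiguity: the ray \<open>r\<close> may leave on
    either side of \<open>q\<close>.\<close>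
  then have "(exp (a / 2) * sin \<rho> * cos \<sigma>)\<^sup>2 = (exp (- a / 2) * cos \<rho> * sin \<sigma>)\<^sup>2"
    by simp
  moreover have "(exp (a / 2))\<^sup>2 = exp a" "(exp (- a / 2))\<^sup>2 = exp (- a)"
    by (simp_all flip: exp_double)
  ultimately have "exp a * (cos \<sigma>)\<^sup>2 = exp (- a) * (sin \<sigma>)\<^sup>2"
    unfolding power_mult_distrib \<rho>2 by simp
  moreover have "tangent_angle (- velocity q a) (velocity u 0) = arccos (- cos (2 * \<sigma>))"
    unfolding q u using geodesic_line_vline[of 0] tangent_angle_translation_rotation[of a \<sigma>]
    by (subst tangent_angle_moebius[OF Q(1)]) (simp_all add: moebius_translation_vline)
  ultimately show "\<theta> = 2 * arctan (exp (- a))"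
    using \<theta> arccos_cos_double_arctan_exp by simp
next
  assume \<theta>: "\<theta> = 2 * arctan (exp (- a))"
  show "right_ideal_triangle a \<theta>"
    unfolding right_ideal_triangle_def
  proof (intro exI conjI)
    \<comment> \<open>With the parameter \<open>pi / 4\<close> for \<open>r\<close>, asymptoticity
      demands the tangent \<open>exp a\<close> for the parameter of \<open>u\<close>.\<close>
    let ?\<sigma> = "arctan (exp a)"
    let ?r = "\<lambda>t. moebius (rotation (pi / 4)) (vline (t - 0))"
    let ?u = "\<lambda>t. moebius (translation a) (moebius (rotation ?\<sigma>) (vline (t - 0)))"
    let ?q = "\<lambda>t. vline (t - 0)"
    show "geodesic_line ?q" "geodesic_line ?r" "geodesic_line ?u"
      using geodesic_line_vline[of 0] by simp_all
    show "?r 0 = ?q 0" "?u 0 = ?q a"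
      by (simp_all add: moebius_translation_vline)
    have "sin ?\<sigma> = exp a * cos ?\<sigma>"
      by (simp add: sin_arctan cos_arctan)
    moreover have "exp (- a / 2) * exp a = exp (a / 2)"
      by (simp flip: exp_add)
    ultimately have "exp (- a / 2) * sin ?\<sigma> = exp (a / 2) * cos ?\<sigma>"
      by (simp flip: mult.assoc)
    then show "asymptotic_rays ?r ?u"
      by (simp add: asymptotic_rays_normal_form sin_45 cos_45 mult.commute mult.left_commute)
    show "tangent_angle (velocity ?q 0) (velocity ?r 0) = pi / 2"
      by (simp only: velocity_vline velocity_moebius_rotation_vline tangent_angle_cis) simp
    have "exp a = exp (- a) * (exp a)\<^sup>2"
      by (simp add: power2_eq_square flip: exp_add)
    then have "exp a * (cos ?\<sigma>)\<^sup>2 = exp (- a) * (sin ?\<sigma>)\<^sup>2"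
      unfolding \<open>sin ?\<sigma> = _\<close> power_mult_distrib by (metis mult.assoc)
    from arccos_cos_double_arctan_exp[OF this]
    show "tangent_angle (- velocity ?q a) (velocity ?u 0) = \<theta>"
      using tangent_angle_translation_rotation[of a ?\<sigma>] \<theta> by simp
  qed
qed

lemma angle_of_parallelism_eq: "angle_of_parallelism a = 2 * arctan (exp (- a))"
  by (simp add: angle_of_parallelism_def right_ideal_triangle_iff)

section \<open>Discrete torsion-free groups\<close>

text \<open>Fixing \<i> makes \<open>A\<close> a rotation, and fixing a second point kills its sine.
  Matrices can thus be recovered, up to sign, from the action on two points of the axis.\<close>

lemma moebius_fixes_vline:
  assumes "det A = 1" "moebius A (vline 0) = vline 0" "moebius A (vline 1) = vline 1"
  shows "A = mat 1 \<or> A = - mat 1"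
proof -
  obtain \<psi> where A: "A = rotation \<psi>"
    using stabilizer_vline_0[OF assms(1,2)] by blast
  define E F :: real where "E = exp 1" and "F = exp (- 1)"
  have sum: "(cos \<psi>)\<^sup>2 + (F * sin \<psi>)\<^sup>2 + (E * sin \<psi>)\<^sup>2 + (cos \<psi>)\<^sup>2 = 2"
    using cosh_dist_vline_moebius_vline[OF assms(1), of 1] assms(3) by (simp add: A E_def F_def)
  have EF: "E * F = 1"
    by (simp add: E_def F_def flip: exp_add)
  have "(E - F)\<^sup>2 * y\<^sup>2 = x\<^sup>2 + (F * y)\<^sup>2 + (E * y)\<^sup>2 + x\<^sup>2 - 2 * (y\<^sup>2 + x\<^sup>2) - 2 * y\<^sup>2 * (E * F - 1)"
    for x y :: real
    by (simp add: power2_eq_square algebra_simps)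
  from this[of "sin \<psi>" "cos \<psi>"] have "(E - F)\<^sup>2 * (sin \<psi>)\<^sup>2 = 0"
    unfolding sum EF sin_cos_squared_add by simp
  moreover have "E \<noteq> F"
    by (simp add: E_def F_def)
  ultimately have "sin \<psi> = 0"
    by simp
  moreover from this have "cos \<psi> = 1 \<or> cos \<psi> = - 1"
    using sin_cos_squared_add[of \<psi>] by (simp add: power2_eq_1_iff)
  ultimately show ?thesis
    by (auto simp: A matrix_eq_2_iff)
qed

section \<open>Transfer of discreteness to matrices\<close>

lemma continuous_on_hyp_plane:
  fixes g :: "'a :: topological_space \<Rightarrow> hyp_plane"
  assumes "continuous_on S (\<lambda>x. coord (g x))"
  shows "continuous_on S g"
  unfolding continuous_on_def
proof
  fix a assume a: "a \<in> S"
  have g: "((\<lambda>x. coord (g x)) \<longlongrightarrow> coord (g a)) (at a within S)"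
    using assms a by (simp add: continuous_on_def)
  have "((\<lambda>x. dist (g x) (g a)) \<longlongrightarrow>
      2 * arsinh (norm (coord (g a) - coord (g a)) / (2 * sqrt (Im (coord (g a)) * Im (coord (g a))))))
      (at a within S)"
    unfolding dist_hyp_plane_def using Im_coord_pos[of "g a"]
    by (intro tendsto_intros g) auto
  then show "(g \<longlongrightarrow> g a) (at a within S)"
    by (subst tendsto_dist_iff) simp
qed

text \<open>The target carries the product topology, the one in which \<open>discrete\<close> is
  meant, so continuity is checked pointwise.\<close>

lemma continuous_on_moebius: "continuous_on {A. det A = 1} moebius"
proof (rule continuous_on_coordinatewise_then_product, rule continuous_on_hyp_plane)
  fix z
  have "continuous_on {A. det A = 1}
      (\<lambda>A. (of_real (A$1$1) * coord z + of_real (A$1$2)) / moebius_denom A z)"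
    using moebius_denom_nonzero[of _ z] unfolding moebius_denom_def
    by (intro continuous_intros) auto
  then show "continuous_on {A. det A = 1} (\<lambda>A. coord (moebius A z))"
    by (rule continuous_on_eq) (simp add: coord_moebius)
qed

lemma discrete_moebius:
  assumes "discrete \<Gamma>" "det A = 1" "moebius A \<in> \<Gamma>"
  obtains U where "open U" "A \<in> U"
    "\<And>B. B \<in> U \<Longrightarrow> det B = 1 \<Longrightarrow> moebius B \<in> \<Gamma> \<Longrightarrow> moebius B = moebius A"
proof -
  obtain T where T: "open T" "T \<inter> \<Gamma> = {moebius A}"
    using assms by (auto simp: discrete_def isolated_in_def)
  then obtain U where U: "open U" "U \<inter> {A. det A = 1} = moebius -` T \<inter> {A. det A = 1}"
    using continuous_on_moebius unfolding continuous_on_open_invariant by metis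
  show thesis
  proof (rule that[OF U(1)])
    show "A \<in> U"
      using T U assms by blast
    show "moebius B = moebius A" if "B \<in> U" "det B = 1" "moebius B \<in> \<Gamma>" for B
      using T U that by blast
  qed
qed

text \<open>A neighbourhood isolating a chosen matrix of each element can be shrunk to a member of a
  countable basis of the matrix space, and distinct elements get distinct members.\<close>

lemma countable_discrete_moebius:
  assumes "discrete \<Gamma>" "\<And>f. f \<in> \<Gamma> \<Longrightarrow> \<exists>A. det A = 1 \<and> f = moebius A"
  shows "countable \<Gamma>"
proof -
  obtain M where M: "det (M f) = 1" "moebius (M f) = f" if "f \<in> \<Gamma>" for f
    using assms(2) by metis
  obtain \<B> :: "(real^2^2) set set" where \<B>: "countable \<B>" "topological_basis \<B>"
    using ex_countable_basis by blast
  have "\<exists>V\<in>\<B>. M f \<in> V \<and> (\<forall>g\<in>\<Gamma>. M g \<in> V \<longrightarrow> g = f)" if f: "f \<in> \<Gamma>" for f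
  proof -
    have "det (M f) = 1" "moebius (M f) \<in> \<Gamma>"
      using f M by auto
    then obtain U where "open U" "M f \<in> U"
      and U: "\<And>B. B \<in> U \<Longrightarrow> det B = 1 \<Longrightarrow> moebius B \<in> \<Gamma> \<Longrightarrow> moebius B = moebius (M f)"
      using discrete_moebius[OF assms(1)] by blast
    then obtain V where "V \<in> \<B>" "M f \<in> V" "V \<subseteq> U"
      using topological_basisE[OF \<B>(2)] by metis
    then show ?thesis
      using U M f by (metis subsetD)
  qed
  then obtain V where "\<And>f. f \<in> \<Gamma> \<Longrightarrow> V f \<in> \<B> \<and> M f \<in> V f \<and> (\<forall>g\<in>\<Gamma>. M g \<in> V f \<longrightarrow> g = f)"
    by metis
  then have "inj_on V \<Gamma>" "V ` \<Gamma> \<subseteq> \<B>"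
    by (auto simp: inj_on_def)
  then show ?thesis
    using \<B>(1) by (metis countable_image_inj_on countable_subset)
qed

lemma surface_group_moebius:
  assumes "hyperbolic_surface_group \<Gamma>" "orientable_surface \<Gamma>" "f \<in> \<Gamma>"
  obtains A where "det A = 1" "f = moebius A"
proof -
  have "f \<in> carrier hyp_isometries"
    using assms unfolding hyperbolic_surface_group_def by (meson subgroup.mem_carrier)
  moreover have "orientation_preserving f"
    using assms by (simp add: orientable_surface_def)
  ultimately show thesis
    using that by (rule orientation_preserving_isometry_moebius)
qed

text \<open>At each time the two lifts differ by some element of \<Gamma>. There are uncountably
  many times and only countably many elements, so one element serves two times, and geodesic lines
  agreeing at two times coincide.\<close>

lemma geodesic_lift_unique:
  assumes "hyperbolic_surface_group \<Gamma>" "orientable_surface \<Gamma>"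
    and "geodesic_lift \<Gamma> \<gamma> c" "geodesic_lift \<Gamma> \<gamma> d"
  obtains g where "g \<in> \<Gamma>" "\<And>t. d t = g (c t)"
proof -
  have \<Gamma>: "subgroup \<Gamma> hyp_isometries" "discrete \<Gamma>"
    using assms(1) by (simp_all add: hyperbolic_surface_group_def)
  have "id \<in> \<Gamma>"
    using subgroup.one_closed[OF \<Gamma>(1)] by (simp add: hyp_isometries_def)
  then have "d t \<in> surface_proj \<Gamma> (d t)" for t
    unfolding surface_proj_def by (metis id_apply image_eqI)
  then have "d t \<in> surface_proj \<Gamma> (c t)" for t
    using assms(3,4) by (simp add: geodesic_lift_def)
  then have "\<forall>t. \<exists>g\<in>\<Gamma>. d t = g (c t)"
    by (auto simp: surface_proj_def)
  then obtain G where G: "G t \<in> \<Gamma>" "d t = G t (c t)" for t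
    by metis
  have "countable \<Gamma>"
    using countable_discrete_moebius[OF \<Gamma>(2)] surface_group_moebius[OF assms(1,2)] by metis
  then have "\<not> inj G"
    using G(1) uncountable_UNIV_real countable_image_inj_on[of G UNIV]
    by (metis countable_subset image_subsetI)
  then obtain s t where st: "G s = G t" "s \<noteq> t"
    by (auto simp: inj_def)
  obtain A where A: "det A = 1" "G s = moebius A"
    using surface_group_moebius[OF assms(1,2) G(1)] .
  have "d u = moebius A (c u)" for u
  proof (rule geodesic_line_eqI[OF _ _ _ _ st(2)])
    show "geodesic_line d" "geodesic_line (\<lambda>u. moebius A (c u))"
      using assms(3,4) A(1) by (simp_all add: geodesic_lift_def)
    show "d s = moebius A (c s)" "d t = moebius A (c t)"
      using G(2)[of s] G(2)[of t] A(2) st(1) by simp_all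
  qed
  then show thesis
    using that[OF G(1)[of s]] A(2) by simp
qed

text \<open>The full preimage of \<Gamma> in SL(2, R), closed under sign changes. Traces are well
  defined here, but only up to sign on \<Gamma>.\<close>

definition matrix_group :: "(hyp_plane \<Rightarrow> hyp_plane) set \<Rightarrow> (real^2^2) set" where
  "matrix_group \<Gamma> = {A. det A = 1 \<and> moebius A \<in> \<Gamma>}"

lemma matrix_group_mult:
  assumes "subgroup \<Gamma> hyp_isometries" "A \<in> matrix_group \<Gamma>" "B \<in> matrix_group \<Gamma>"
  shows "A ** B \<in> matrix_group \<Gamma>"
proof -
  have "moebius (A ** B) = moebius A \<circ> moebius B"
    using assms by (auto simp: matrix_group_def moebius_mult)
  also have "\<dots> \<in> \<Gamma>"
    using subgroup.m_closed[OF assms(1), of "moebius A" "moebius B"] assms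
    by (simp add: matrix_group_def hyp_isometries_def)
  finally show ?thesis
    using assms by (simp add: matrix_group_def det_mul)
qed

lemma matrix_group_adj2:
  assumes "subgroup \<Gamma> hyp_isometries" "A \<in> matrix_group \<Gamma>"
  shows "adj2 A \<in> matrix_group \<Gamma>"
proof -
  have A: "det A = 1" "moebius A \<in> \<Gamma>"
    using assms(2) by (auto simp: matrix_group_def)
  have "moebius A \<in> carrier hyp_isometries"
    using subgroup.mem_carrier[OF assms(1)] A by blast
  moreover have "moebius (adj2 A) \<in> carrier hyp_isometries"
    using A(1) by (auto simp: hyp_isometries_def intro!: bij_betw_byWitness[where f' = "moebius A"])
  moreover have "moebius (adj2 A) \<otimes>\<^bsub>hyp_isometries\<^esub> moebius A = \<one>\<^bsub>hyp_isometries\<^esub>"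
    using A(1) by (auto simp: hyp_isometries_def)
  ultimately have "inv\<^bsub>hyp_isometries\<^esub> (moebius A) = moebius (adj2 A)"
    by (intro group.inv_equality[OF group_hyp_isometries])
  then have "moebius (adj2 A) \<in> \<Gamma>"
    using subgroup.m_inv_closed[OF assms(1) A(2)] by simp
  then show ?thesis
    using A(1) by (simp add: matrix_group_def)
qed

lemma matrix_group_minus: "A \<in> matrix_group \<Gamma> \<Longrightarrow> - A \<in> matrix_group \<Gamma>"
proof -
  have "moebius (- A) = moebius A" by auto
  then show "A \<in> matrix_group \<Gamma> \<Longrightarrow> - A \<in> matrix_group \<Gamma>"
    by (simp add: matrix_group_def)
qed

text \<open>If \<open>\<bar>tr A\<bar> < 2\<close> then \<open>A\<close> is conjugate to a rotation by some \<open>\<theta>\<close>, and the powers of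
  \<open>A\<close> are the values at the multiples of \<open>\<theta>\<close> of a \<open>2 * pi\<close>-periodic one-parameter group.\<close>

lemma matrix_group_no_elliptic:
  assumes "hyperbolic_surface_group \<Gamma>" "A \<in> matrix_group \<Gamma>"
  shows "2 \<le> \<bar>trace A\<bar>"
proof (rule ccontr)
  assume "\<not> 2 \<le> \<bar>trace A\<bar>"
  then have tr: "-1 < trace A / 2" "trace A / 2 < 1"
    by (auto simp: abs_if split: if_splits)
  have \<Gamma>: "subgroup \<Gamma> hyp_isometries" "discrete \<Gamma>" and A: "det A = 1" "moebius A \<in> \<Gamma>"
    and torsion_free: "\<And>n. 0 < n \<Longrightarrow> moebius A ^^ n = id \<Longrightarrow> moebius A = id"
    using assms by (auto simp: hyperbolic_surface_group_def matrix_group_def)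
  define \<theta> where "\<theta> = arccos (trace A / 2)"
  have "cos \<theta> = trace A / 2"
    using tr by (simp add: \<theta>_def)
  then have \<theta>: "2 * cos \<theta> = trace A" by simp
  have "sin \<theta> > 0"
    using tr by (intro sin_gt_zero) (auto simp: \<theta>_def arccos_lt_bounded)
  \<comment> \<open>The closed formula for the powers of a matrix of determinant 1 and trace
    \<open>2 * cos \<theta>\<close>, with a real variable \<open>x\<close> in place of
    \<open>n * \<theta>\<close>.\<close>
  define P where "P x = (sin x / sin \<theta>) *\<^sub>R A - (sin (x - \<theta>) / sin \<theta>) *\<^sub>R mat 1" for x
  have P_nth: "P x $ i $ j = (sin x * A$i$j - sin (x - \<theta>) * (mat 1 :: real^2^2)$i$j) / sin \<theta>" for x i j
    by (simp add: P_def diff_divide_distrib)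
  have P0: "P 0 = mat 1"
    using \<open>sin \<theta> > 0\<close> by (simp add: matrix_eq_2_iff P_nth)
  \<comment> \<open>Cayley-Hamilton for \<open>A\<close> matches the recursion of the sine under
    steps of \<open>\<theta>\<close>.\<close>
  have P_add: "P (x + \<theta>) = A ** P x" for x
  proof -
    have P_sin: "sin \<theta> * P y $ i $ j = sin y * A$i$j - sin (y - \<theta>) * (mat 1 :: real^2^2)$i$j" for y i j
      using \<open>sin \<theta> > 0\<close> by (simp add: P_nth)
    have sin_add_\<theta>: "sin (x + \<theta>) = (A$1$1 + A$2$2) * sin x - sin (x - \<theta>)"
      by (simp add: sin_add sin_diff flip: \<theta> trace_2)
    have det: "y * (A$1$1 * A$2$2) = y + y * (A$1$2 * A$2$1)" for y
      using A(1) by (simp add: det_2 algebra_simps flip: distrib_left)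
    have "sin \<theta> * P (x + \<theta>) $ i $ j = A$i$1 * (sin \<theta> * P x $ 1 $ j) + A$i$2 * (sin \<theta> * P x $ 2 $ j)"
      for i j
      using exhaust_2[of i] exhaust_2[of j] unfolding P_sin sin_add_\<theta>
      by (elim disjE; simp add: algebra_simps det)
    then have "sin \<theta> * P (x + \<theta>) $ i $ j = sin \<theta> * (A ** P x) $ i $ j" for i j
      by (simp add: matrix_mult_nth_2 algebra_simps)
    then show ?thesis
      using \<open>sin \<theta> > 0\<close> by (simp add: matrix_eq_2_iff)
  qed
  have P_power: "det (P (real n * \<theta>)) = 1 \<and> moebius (P (real n * \<theta>)) = moebius A ^^ n" for n
  proof (induction n)
    case 0
    have "moebius (mat 1) = id" by auto
    then show ?case by (simp add: P0 det_I)
  next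
    case (Suc n)
    have "P (real (Suc n) * \<theta>) = A ** P (real n * \<theta>)"
      using P_add[of "real n * \<theta>"] by (simp add: algebra_simps)
    moreover have "moebius (A ** P (real n * \<theta>)) = moebius A \<circ> moebius A ^^ n"
      using Suc A(1) by (auto simp: moebius_mult)
    ultimately show ?case
      using Suc A(1) by (simp add: det_mul)
  qed
  have in_\<Gamma>: "moebius A ^^ n \<in> \<Gamma>" for n
  proof (induction n)
    case 0
    then show ?case
      using subgroup.one_closed[OF \<Gamma>(1)] by (simp add: hyp_isometries_def id_def)
  next
    case (Suc n)
    then show ?case
      using subgroup.m_closed[OF \<Gamma>(1) A(2)] by (simp add: hyp_isometries_def o_def)
  qed
  have id: "moebius (mat 1) = id" by auto
  have "moebius A ^^ 0 = moebius (mat 1)"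
    unfolding id by simp
  then have "moebius (mat 1) \<in> \<Gamma>"
    using in_\<Gamma>[of 0] by (simp only:)
  then obtain U where U: "open U" "mat 1 \<in> U"
    "\<And>B. B \<in> U \<Longrightarrow> det B = 1 \<Longrightarrow> moebius B \<in> \<Gamma> \<Longrightarrow> moebius B = moebius (mat 1)"
    using discrete_moebius[OF \<Gamma>(2)] det_I by metis
  have "isCont P 0"
    unfolding P_def[abs_def] using \<open>sin \<theta> > 0\<close> by (intro continuous_intros) auto
  then have "(P \<longlongrightarrow> P 0) (nhds 0)"
    unfolding isCont_def tendsto_at_iff_tendsto_nhds .
  from topological_tendstoD[OF this U(1)] have "\<forall>\<^sub>F x in nhds 0. P x \<in> U"
    using U(2) by (simp add: P0)
  then obtain \<delta> where \<delta>: "\<delta> > 0" "\<And>x. \<bar>x\<bar> < \<delta> \<Longrightarrow> P x \<in> U"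
    unfolding eventually_nhds_metric by (auto simp: dist_real_def)
  \<comment> \<open>Dirichlet approximation of \<open>\<theta> / (2 * pi)\<close> with this
    \<open>N\<close> yields a positive multiple of \<open>\<theta>\<close> within
    \<open>\<delta>\<close> of a multiple of \<open>2 * pi\<close>.\<close>
  obtain N where N: "2 * pi / \<delta> < real N"
    using reals_Archimedean2 by blast
  with \<delta>(1) have "N > 0"
    by (cases N) (auto simp: field_simps not_less)
  then obtain h k :: int where k: "0 < k" "\<bar>of_int k * (\<theta> / (2 * pi)) - of_int h\<bar> < 1 / N"
    using Dirichlet_approx by metis
  define x where "x = of_int k * \<theta> - 2 * pi * of_int h"
  have "\<bar>x\<bar> = 2 * pi * \<bar>of_int k * (\<theta> / (2 * pi)) - of_int h\<bar>"
    by (simp add: x_def abs_mult_pos' field_simps flip: abs_mult_pos)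
  also have "\<dots> < 2 * pi * (1 / N)"
    using k(2) by (intro mult_strict_left_mono) auto
  also have "\<dots> < \<delta>"
    using N \<delta>(1) \<open>N > 0\<close> by (simp add: field_simps)
  finally have "P x \<in> U"
    by (rule \<delta>(2))
  have periodic: "sin (y - 2 * pi * of_int h) = sin y" for y
    by (simp add: sin_diff)
  have "P x = P (of_int k * \<theta>)"
    using periodic[of "of_int k * \<theta>"] periodic[of "of_int k * \<theta> - \<theta>"]
    by (simp add: P_def x_def algebra_simps)
  also have "of_int k * \<theta> = real (nat k) * \<theta>"
    using k(1) by simp
  finally have "P (real (nat k) * \<theta>) \<in> U"
    using \<open>P x \<in> U\<close> by simp
  \<comment> \<open>Discreteness forces this power, whose matrix is close to the identity, to be
    trivial; torsion-freeness then applies since \<open>nat k\<close> is positive.\<close>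
  then have "moebius A ^^ nat k = id"
    using U(3) P_power in_\<Gamma> id by metis
  then have "moebius A = id"
    by (rule torsion_free[rotated]) (use k(1) in simp)
  then have "A = mat 1 \<or> A = - mat 1"
    using A(1) by (intro moebius_fixes_vline) simp_all
  then show False
    using tr by (auto simp: trace_2)
qed

section \<open>Trace reduction\<close>

text \<open>The trace of the commutator of \<open>X\<close> and \<open>Y\<close> in terms of the traces of \<open>X\<close>, \<open>Y\<close> and \<open>X ** Y\<close>
  (Fricke).\<close>

definition commutator_trace :: "real \<Rightarrow> real \<Rightarrow> real \<Rightarrow> real" where
  "commutator_trace x y z = x\<^sup>2 + y\<^sup>2 + z\<^sup>2 - x * y * z - 2"

text \<open>Vieta: the expression is quadratic in \<open>z\<close>, and the two roots for a given
  value add up to \<open>x * y\<close>.\<close>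

lemma commutator_trace_reflect: "commutator_trace x y (x * y - z) = commutator_trace x y z"
  by (simp add: commutator_trace_def power2_eq_square algebra_simps)

text \<open>The largest entry \<open>z\<close> of a triple is replaced by the other root \<open>x * y - z\<close> of the
  quadratic equation that it satisfies. As long as the entries stay \<open>\<ge> 2\<close>, this decreases the sum by at
  least a constant that depends on the commutator trace only.\<close>

lemma trace_reduction:
  fixes R :: "real \<Rightarrow> real \<Rightarrow> real \<Rightarrow> bool"
  assumes swap: "\<And>x y z. R x y z \<Longrightarrow> R y x z" "\<And>x y z. R x y z \<Longrightarrow> R x z y"
    and reflect: "\<And>x y z. R x y z \<Longrightarrow> R x y (x * y - z)"
    and no_elliptic: "\<And>x y z. R x y z \<Longrightarrow> 2 \<le> \<bar>z\<bar>"
    and R: "R x y z" and ge_2: "2 \<le> x" "2 \<le> y" "2 \<le> z"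
    and \<kappa>: "2 < commutator_trace x y z"
  shows "18 \<le> commutator_trace x y z"
proof -
  define \<kappa> where "\<kappa> = commutator_trace x y z"
  define \<delta> where "\<delta> = 2 * sqrt (\<kappa> - 2)"
  have "2 < \<kappa>"
    using \<kappa> by (simp add: \<kappa>_def)
  then have \<delta>: "\<delta> > 0" "\<delta>\<^sup>2 = 4 * (\<kappa> - 2)"
    by (simp_all add: \<delta>_def power_mult_distrib)
  \<comment> \<open>Induction on a bound for the number of moves, with the sum measured in units of
    \<open>\<delta>\<close>. The sum of the entries is at least 6, so \<open>n = 0\<close> cannot
    occur.\<close>
  have "18 \<le> \<kappa>"
    if "R x y z" "2 \<le> x" "2 \<le> y" "2 \<le> z" "commutator_trace x y z = \<kappa>" "x + y + z - 6 < real n * \<delta>" for n x y z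
    using that
  proof (induction n arbitrary: x y z)
    case 0
    then show ?case by simp
  next
    case (Suc n)
    have step: "18 \<le> \<kappa>"
      if R: "R x y z" and ge_2: "2 \<le> x" "2 \<le> y" "2 \<le> z" and \<kappa>: "commutator_trace x y z = \<kappa>"
        and sum: "x + y + z - 6 < real (Suc n) * \<delta>" and sorted: "x \<le> y" "y \<le> z" for x y z
    proof -
      define z' where "z' = x * y - z"
      have R': "R x y z'" and \<kappa>': "commutator_trace x y z' = \<kappa>"
        using R reflect \<kappa> by (simp_all add: z'_def commutator_trace_reflect)
      show ?thesis
      proof (cases "2 \<le> z'")
        case False
        then have "z' \<le> - 2"
          using no_elliptic[OF R'] by linarith
        \<comment> \<open>The reduction stops here: three squares of at least 4 and a product term
          of at least 8 give 4 + 4 + 4 + 8 - 2 = 18.\<close>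
        then have "2\<^sup>2 \<le> x\<^sup>2" "2\<^sup>2 \<le> y\<^sup>2" "2\<^sup>2 \<le> (- z')\<^sup>2" "2 * 2 * 2 \<le> x * y * (- z')"
          using ge_2 by (intro power_mono mult_mono; simp)+
        then show ?thesis
          by (simp flip: \<kappa>' add: commutator_trace_def)
      next
        case True
        \<comment> \<open>The quadratic with roots \<open>z\<close> and \<open>z'\<close> is
          evaluated at \<open>y\<close>. A negative value puts \<open>y\<close> strictly between the
          roots, so the new entry is smaller than \<open>y\<close>.\<close>
        have "(y - z) * (y - z') = (2 - x) * y\<^sup>2 + x\<^sup>2 - \<kappa> - 2"
          by (simp add: z'_def commutator_trace_def power2_eq_square algebra_simps flip: \<kappa>)
        also have "\<dots> \<le> (2 - x) * x\<^sup>2 + x\<^sup>2 - \<kappa> - 2"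
          using ge_2 sorted by (simp add: mult_left_mono_neg power_mono)
        also have "\<dots> = (2 - \<kappa>) - (x - 2)\<^sup>2 * (x + 1)"
          by (simp add: power2_eq_square algebra_simps)
        also have "\<dots> < 0"
        proof -
          have "0 \<le> (x - 2)\<^sup>2 * (x + 1)"
            using ge_2 by (intro mult_nonneg_nonneg) auto
          with \<open>2 < \<kappa>\<close> show ?thesis by linarith
        qed
        finally have "(y - z) * (y - z') < 0" .
        then have "z' < y"
          using sorted by (auto simp: mult_less_0_iff)
        have "0 \<le> (x\<^sup>2 - 4) * (y\<^sup>2 - 4)"
          using ge_2 power_mono[of 2 x 2] power_mono[of 2 y 2] by simp
        \<comment> \<open>The discriminant of that quadratic, from which the constant
          \<open>\<delta>\<close> comes.\<close>
        moreover have "(z - z')\<^sup>2 = (x\<^sup>2 - 4) * (y\<^sup>2 - 4) + 4 * (\<kappa> - 2)"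
          by (simp add: z'_def commutator_trace_def power2_eq_square algebra_simps flip: \<kappa>)
        ultimately have "\<delta>\<^sup>2 \<le> (z - z')\<^sup>2"
          by (simp add: \<delta>)
        then have "\<delta> \<le> z - z'"
          using \<open>z' < y\<close> sorted by (intro power2_le_imp_le[of \<delta>]) auto
        then have "x + y + z' - 6 < real n * \<delta>"
          using sum by (simp add: algebra_simps)
        with Suc.IH R' ge_2 True \<kappa>' show ?thesis
          by blast
      qed
    qed
    \<comment> \<open>All hypotheses are symmetric in the three entries, so the sorted case
      suffices.\<close>
    have rotate: "R y z x" "R z x y" "R z y x" "R x z y" "R y x z"
      using swap Suc.prems(1) by blast+
    have \<kappa>: "commutator_trace y z x = \<kappa>" "commutator_trace z x y = \<kappa>" "commutator_trace z y x = \<kappa>"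
      "commutator_trace x z y = \<kappa>" "commutator_trace y x z = \<kappa>"
      using Suc.prems(5) by (simp_all add: commutator_trace_def algebra_simps)
    have sum: "y + z + x - 6 < real (Suc n) * \<delta>" "z + x + y - 6 < real (Suc n) * \<delta>"
      "z + y + x - 6 < real (Suc n) * \<delta>" "x + z + y - 6 < real (Suc n) * \<delta>"
      "y + x + z - 6 < real (Suc n) * \<delta>"
      using Suc.prems(6) by linarith+
    consider "x \<le> y" "y \<le> z" | "x \<le> z" "z \<le> y" | "y \<le> x" "x \<le> z" | "y \<le> z" "z \<le> x"
      | "z \<le> x" "x \<le> y" | "z \<le> y" "y \<le> x"
      by linarith
    then show ?case
      using step rotate \<kappa> sum Suc.prems by cases blast+
  qed
  moreover obtain n where "(x + y + z - 6) / \<delta> < real n"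
    using reals_Archimedean2 by blast
  then have "x + y + z - 6 < real n * \<delta>"
    using \<delta>(1) by (simp add: field_simps)
  ultimately show ?thesis
    using R ge_2 by (simp add: \<kappa>_def)
qed

text \<open>Forgetting the matrices lets the reduction work with real numbers only.\<close>

definition trace_triple :: "(hyp_plane \<Rightarrow> hyp_plane) set \<Rightarrow> real \<Rightarrow> real \<Rightarrow> real \<Rightarrow> bool" where
  "trace_triple \<Gamma> x y z \<longleftrightarrow> (\<exists>X\<in>matrix_group \<Gamma>. \<exists>Y\<in>matrix_group \<Gamma>.
     trace X = x \<and> trace Y = y \<and> trace (X ** Y) = z)"

text \<open>The moves are realised by passing from \<open>(X, Y)\<close> to \<open>(Y, X)\<close>,
  \<open>(adj2 X, X ** Y)\<close> and \<open>(X, adj2 Y)\<close>. Absence of elliptic elements is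
  applied to \<open>X ** Y\<close>.\<close>

lemma trace_triple_commutator_trace:
  assumes "hyperbolic_surface_group \<Gamma>" "trace_triple \<Gamma> x y z"
    and "2 \<le> x" "2 \<le> y" "2 \<le> z" "2 < commutator_trace x y z"
  shows "18 \<le> commutator_trace x y z"
proof (rule trace_reduction[of "trace_triple \<Gamma>"])
  have \<Gamma>: "subgroup \<Gamma> hyp_isometries"
    using assms(1) by (simp add: hyperbolic_surface_group_def)
  fix x y z assume "trace_triple \<Gamma> x y z"
  then obtain X Y where X: "X \<in> matrix_group \<Gamma>" "trace X = x" and Y: "Y \<in> matrix_group \<Gamma>" "trace Y = y"
    and XY: "trace (X ** Y) = z"
    by (auto simp: trace_triple_def)
  have "trace (Y ** X) = z"
    using XY trace_mul_sym by metis
  with X Y show "trace_triple \<Gamma> y x z"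
    unfolding trace_triple_def by blast
  have "det X = 1"
    using X by (simp add: matrix_group_def)
  then have "trace (adj2 X ** (X ** Y)) = y" "trace (adj2 X) = x"
    using X Y by (simp_all add: matrix_mul_assoc adj2_mult trace_2 add.commute)
  then show "trace_triple \<Gamma> x z y"
    unfolding trace_triple_def using X Y XY \<Gamma> matrix_group_adj2 matrix_group_mult by blast
  have "trace (X ** adj2 Y) = x * y - z"
    using X Y XY by (simp add: trace_mult_adj2)
  moreover have "trace (adj2 Y) = y"
    using Y by (simp add: trace_2 add.commute)
  ultimately show "trace_triple \<Gamma> x y (x * y - z)"
    unfolding trace_triple_def using X Y \<Gamma> matrix_group_adj2 by blast
  show "2 \<le> \<bar>z\<bar>"
    using matrix_group_no_elliptic[OF assms(1) matrix_group_mult[OF \<Gamma> X(1) Y(1)]] XY by simp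
qed (use assms in auto)

section \<open>Self-intersections of closed geodesics\<close>

lemma trace_rotation_translation: "trace (rotation \<psi> ** translation a) = 2 * cos \<psi> * cosh (a / 2)"
  by (simp add: trace_2 matrix_mult_nth_2 cosh_field_def algebra_simps)

lemma trace_conj_adj2:
  assumes "det C = 1"
  shows "trace (adj2 C ** A ** C) = trace A"
proof -
  have "trace (adj2 C ** A ** C) = trace (C ** (adj2 C ** A))"
    by (rule trace_mul_sym)
  then show ?thesis
    by (simp add: matrix_mul_assoc adj2_mult assms)
qed

lemma conj_adj2_mult:
  assumes "det C = 1"
  shows "adj2 C ** (A ** B) ** C = (adj2 C ** A ** C) ** (adj2 C ** B ** C)"
proof -
  have "(adj2 C ** A ** C) ** (adj2 C ** B ** C) = adj2 C ** A ** (C ** adj2 C) ** B ** C"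
    by (simp add: matrix_mul_assoc)
  then show ?thesis
    by (simp add: adj2_mult assms matrix_mul_assoc)
qed

lemma closed_geodesic_period:
  assumes "closed_geodesic \<Gamma> \<gamma> l"
  shows "\<gamma> (t + of_int k * l) = \<gamma> t"
proof -
  have period: "\<gamma> (t + l) = \<gamma> t" for t
    using assms by (simp add: closed_geodesic_def)
  show ?thesis
  proof (induction k rule: int_induct[of _ 0])
    case (step1 i)
    then show ?case
      using period[of "t + of_int i * l"] by (simp add: algebra_simps)
  next
    case (step2 i)
    then show ?case
      using period[of "t + of_int (i - 1) * l"] by (simp add: algebra_simps)
  qed simp
qed

text \<open>The self-intersection cuts \<open>\<gamma>\<close> into two loops, of lengths \<open>a\<close> and \<open>l - a\<close>. The two loops
  and \<open>\<gamma>\<close> itself have the given traces.\<close>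

lemma self_intersection_trace_triple:
  assumes "hyperbolic_surface_group \<Gamma>" "orientable_surface \<Gamma>"
    and "closed_geodesic \<Gamma> \<gamma> l" "self_intersection_angle \<Gamma> \<gamma> p \<phi>"
  obtains a where "0 \<le> a" "a \<le> l"
    "trace_triple \<Gamma> (2 * cos (\<phi> / 2) * cosh (a / 2)) (2 * cos (\<phi> / 2) * cosh ((l - a) / 2)) (2 * cosh (l / 2))"
proof -
  have \<Gamma>: "subgroup \<Gamma> hyp_isometries"
    using assms(1) by (simp add: hyperbolic_surface_group_def)
  have l: "0 < l"
    using assms(3) by (simp add: closed_geodesic_def)
  obtain c d s t where c: "geodesic_lift \<Gamma> \<gamma> c" and d: "geodesic_lift \<Gamma> \<gamma> d" and meet: "c s = d t"
    and \<phi>: "\<phi> = tangent_angle (velocity c s) (velocity d t)" "0 < \<phi>" "\<phi> < pi"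
    using assms(4) by (auto simp: self_intersection_angle_def)
  have shift: "geodesic_lift \<Gamma> \<gamma> (\<lambda>u. e (u + of_int k * l))" if "geodesic_lift \<Gamma> \<gamma> e" for e k
    using that closed_geodesic_period[OF assms(3), of _ k]
    by (simp add: geodesic_lift_def geodesic_line_shift)
  obtain C where C: "det C = 1" "\<And>u. c u = moebius C (vline (u - s))"
    using geodesic_line_vlineE[of c s] c by (auto simp: geodesic_lift_def)
  \<comment> \<open>Conjugation by \<open>C\<close> passes to coordinates with \<open>c\<close> on
    the axis and the crossing at \<i>.\<close>
  define conj where "conj A = adj2 C ** A ** C" for A
  have moebius_conj: "moebius (conj A) z = moebius (adj2 C) (moebius A (moebius C z))" "det (conj A) = 1"
    if "det A = 1" for A z
    using that C(1) by (simp_all add: conj_def moebius_mult det_mul)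

  \<comment> \<open>The deck transformation of one full period. In these coordinates it acts on the
    axis like \<open>translation l\<close>, so the matrices agree up to sign.\<close>
  obtain h where h: "h \<in> \<Gamma>" "\<And>u. c (u + of_int 1 * l) = h (c u)"
    using geodesic_lift_unique[OF assms(1,2) c shift[OF c]] by blast
  obtain H' where H': "det H' = 1" "h = moebius H'"
    using surface_group_moebius[OF assms(1,2) h(1)] .
  have "moebius (conj H') (vline u) = vline (u + l)" for u
    using h(2)[of "u + s", symmetric] C by (simp add: moebius_conj H')
  then have "translation (- l) ** conj H' = mat 1 \<or> translation (- l) ** conj H' = - mat 1"
    using H' by (intro moebius_fixes_vline)
      (simp_all add: moebius_mult det_mul moebius_conj moebius_translation_vline)
  moreover have "translation l ** (translation (- l) ** conj H') = conj H'"
    by (simp add: matrix_mul_assoc adj2_mult flip: adj2_translation)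
  moreover have "translation l ** - mat 1 = - translation l"
    by (simp add: matrix_eq_2_iff matrix_mult_nth_2)
  ultimately have "conj H' = translation l \<or> conj H' = - translation l"
    by (metis matrix_mul_rid)
  \<comment> \<open>The representative with positive sign, so that its trace is
    \<open>2 * cosh (l / 2)\<close>.\<close>
  then obtain H where H: "H \<in> matrix_group \<Gamma>" "conj H = translation l"
  proof
    assume "conj H' = - translation l"
    moreover have "conj (- H') = - conj H'"
      by (simp add: conj_def matrix_eq_2_iff matrix_mult_nth_2 algebra_simps)
    ultimately show thesis
      using that[of "- H'"] H' h(1) matrix_group_minus[of H' \<Gamma>] by (simp add: matrix_group_def)
  qed (use H' h(1) that[of H'] in \<open>simp add: matrix_group_def\<close>)

  \<comment> \<open>Removing \<open>k\<close> full periods reduces the parameter difference of the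
    two strands to the length \<open>a\<close> of one loop, between 0 and \<open>l\<close>.\<close>
  define k where "k = \<lfloor>(t - s) / l\<rfloor>"
  define a where "a = t - s - of_int k * l"
  have "of_int k \<le> (t - s) / l" "(t - s) / l < of_int k + 1"
    by (simp_all add: k_def)
  then have a: "0 \<le> a" "a \<le> l"
    using l by (simp_all add: a_def field_simps)
  obtain g where g: "g \<in> \<Gamma>" "\<And>u. d (u + of_int k * l) = g (c u)"
    using geodesic_lift_unique[OF assms(1,2) c shift[OF d]] by blast
  obtain G where G: "det G = 1" "g = moebius G"
    using surface_group_moebius[OF assms(1,2) g(1)] .
  \<comment> \<open>The element \<open>g\<close> maps \<open>c (s + a)\<close> to
    \<open>c s\<close>, so \<open>conj G\<close> undoes the translation by \<open>a\<close> up to a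
    rotation about \<i>.\<close>
  define K where "K = conj G ** translation a"
  have K: "det K = 1"
    using G by (simp add: K_def det_mul moebius_conj)
  have d_eq: "d u = moebius C (moebius K (vline (u - t)))" for u
    using g(2)[of "u - of_int k * l"] C G
    by (simp add: K_def moebius_mult moebius_conj moebius_translation_vline a_def algebra_simps)
  then have "moebius K (vline 0) = vline 0"
    using meet C by (metis diff_self moebius_adj2(1))
  with K obtain \<psi> where \<psi>: "K = rotation \<psi>"
    by (rule stabilizer_vline_0)
  have "K ** translation (- a) = conj G ** (translation a ** adj2 (translation a))"
    by (simp add: K_def matrix_mul_assoc adj2_translation)
  then have conj_G: "conj G = rotation \<psi> ** translation (- a)"
    by (simp add: adj2_mult \<psi>)

  have "\<phi> = tangent_angle (velocity (\<lambda>u. moebius C (vline (u - s))) s)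
      (velocity (\<lambda>u. moebius C (moebius (rotation \<psi>) (vline (u - t)))) t)"
    unfolding \<phi>(1) using C(2) d_eq \<psi> by presburger
  also have "\<dots> = tangent_angle \<i> (\<i> * cis (2 * \<psi>))"
    using geodesic_line_vline[of "- s"] geodesic_line_vline[of "- t"]
    by (subst tangent_angle_moebius[OF C(1)])
      (simp_all only: velocity_vline velocity_moebius_rotation_vline, simp_all)
  finally have "cos \<phi> = cos (2 * \<psi>)"
    by (simp add: tangent_angle_cis)
  \<comment> \<open>The angle determines \<open>\<psi>\<close> up to sign and multiples of
    \<open>pi\<close>, hence its cosine up to sign.\<close>
  then have "(cos (\<phi> / 2))\<^sup>2 = (cos \<psi>)\<^sup>2"
    using cos_double_cos[of "\<phi> / 2"] cos_double_cos[of \<psi>] by simp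
  then have cos_\<psi>: "cos \<psi> = cos (\<phi> / 2) \<or> cos \<psi> = - cos (\<phi> / 2)"
    by (auto simp: power2_eq_iff)

  \<comment> \<open>\<open>X\<close> belongs to the loop of length \<open>a\<close> and
    \<open>Y\<close> to the other one; their product is \<open>H\<close>.\<close>
  define X Y where "X = adj2 G" and "Y = G ** H"
  have "G \<in> matrix_group \<Gamma>"
    using G g(1) by (simp add: matrix_group_def)
  then have XY_in: "X \<in> matrix_group \<Gamma>" "Y \<in> matrix_group \<Gamma>"
    unfolding X_def Y_def using H(1) by (auto intro: matrix_group_adj2[OF \<Gamma>] matrix_group_mult[OF \<Gamma>])
  have trace_X: "trace X = 2 * cos \<psi> * cosh (a / 2)"
  proof -
    have "trace X = trace G"
      by (simp add: X_def trace_2)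
    also have "\<dots> = trace (conj G)"
      by (simp add: conj_def trace_conj_adj2 C)
    finally show ?thesis
      by (simp add: conj_G trace_rotation_translation)
  qed
  have trace_Y: "trace Y = 2 * cos \<psi> * cosh ((l - a) / 2)"
  proof -
    have "trace Y = trace (conj Y)"
      by (simp add: conj_def trace_conj_adj2 C)
    also have "conj Y = conj G ** conj H"
      by (simp add: Y_def conj_def conj_adj2_mult C)
    also have "\<dots> = rotation \<psi> ** (translation (- a) ** translation l)"
      by (simp add: conj_G H(2) matrix_mul_assoc)
    also have "translation (- a) ** translation l = translation (l - a)"
      by (simp add: matrix_eq_2_iff matrix_mult_nth_2 diff_divide_distrib flip: exp_add)
    finally show ?thesis
      by (simp add: trace_rotation_translation)
  qed
  have trace_XY: "trace (X ** Y) = 2 * cosh (l / 2)"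
  proof -
    have "X ** Y = H"
      by (simp add: X_def Y_def matrix_mul_assoc adj2_mult G)
    then have "trace (X ** Y) = trace (conj H)"
      by (simp add: conj_def trace_conj_adj2 C)
    then show ?thesis
      by (simp add: H(2) trace_2 cosh_field_def)
  qed
  show thesis
  proof (rule that[OF a])
    show "trace_triple \<Gamma> (2 * cos (\<phi> / 2) * cosh (a / 2)) (2 * cos (\<phi> / 2) * cosh ((l - a) / 2)) (2 * cosh (l / 2))"
      using cos_\<psi>
    proof
      assume "cos \<psi> = cos (\<phi> / 2)"
      then show ?thesis
        using XY_in trace_X trace_Y trace_XY unfolding trace_triple_def by metis
    next
      assume "cos \<psi> = - cos (\<phi> / 2)"
      \<comment> \<open>Negating both matrices flips the first two traces and keeps the
        product.\<close>
      moreover have "(- X) ** (- Y) = X ** Y"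
        by (simp add: matrix_eq_2_iff matrix_mult_nth_2)
      ultimately show ?thesis
        using XY_in trace_X trace_Y trace_XY unfolding trace_triple_def
        by (intro bexI[of _ "- X"] bexI[of _ "- Y"]) (simp_all add: matrix_group_minus)
    qed
  qed
qed

text \<open>Here \<open>a\<close> and \<open>b\<close> are half the lengths of the loops. By the
  addition formulas the value depends on them only through their sum, so it is the same wherever the
  crossing cuts \<gamma>.\<close>

lemma commutator_trace_loops:
  "commutator_trace (2 * cos \<beta> * cosh a) (2 * cos \<beta> * cosh b) (2 * cosh (a + b))
    = 2 + 4 * (sinh (a + b) * sin \<beta>)\<^sup>2"
proof -
  have "(cosh a)\<^sup>2 + (cosh b)\<^sup>2 - 2 * cosh a * cosh b * cosh (a + b) = - (sinh (a + b))\<^sup>2"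
    unfolding cosh_add sinh_add using cosh_square_eq[of a] cosh_square_eq[of b] by algebra
  then have "4 * (cos \<beta>)\<^sup>2 * ((cosh a)\<^sup>2 + (cosh b)\<^sup>2 - 2 * cosh a * cosh b * cosh (a + b))
      = - (4 * (cos \<beta>)\<^sup>2 * (sinh (a + b))\<^sup>2)"
    by simp
  then show ?thesis
    unfolding commutator_trace_def power_mult_distrib cosh_square_eq[of "a + b"] sin_squared_eq
    by (simp add: power2_eq_square algebra_simps)
qed

text \<open>Passing from \<open>sinh\<close> to \<open>exp\<close> makes both final estimates
  strict.\<close>

lemma sinh_less_exp: "sinh x < exp x" for x :: real
proof -
  have "- exp (- x) < exp x"
    by (rule less_trans[of _ 0]) simp_all
  then show ?thesis
    unfolding sinh_field_def by argo
qed

theorem corollary5p2: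
  fixes \<Gamma> :: "(hyp_plane \<Rightarrow> hyp_plane) set"
    and \<gamma> :: "real \<Rightarrow> hyp_plane set"
    and p :: "hyp_plane set"
    and l \<phi> :: real
  assumes "hyperbolic_surface_group \<Gamma>"
    and "orientable_surface \<Gamma>"
    and "closed_geodesic \<Gamma> \<gamma> l"
    and "self_intersection_angle \<Gamma> \<gamma> p \<phi>"
  shows "angle_of_parallelism (l / 2) < \<phi> \<and> \<phi> < pi - angle_of_parallelism (l / 4)"
proof -
  have l: "0 < l"
    using assms(3) by (simp add: closed_geodesic_def)
  define \<beta> where "\<beta> = \<phi> / 2"
  have \<beta>: "0 < \<beta>" "\<beta> < pi / 2"
    using assms(4) by (auto simp: self_intersection_angle_def \<beta>_def)
  then have pos: "0 < sin \<beta>" "0 < cos \<beta>"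
    by (auto intro: sin_gt_zero cos_gt_zero)
  have tan_\<beta>: "arctan (tan \<beta>) = \<beta>"
    using \<beta> by (intro arctan_tan) auto
  obtain a where a: "0 \<le> a" "a \<le> l"
    "trace_triple \<Gamma> (2 * cos \<beta> * cosh (a / 2)) (2 * cos \<beta> * cosh ((l - a) / 2)) (2 * cosh (l / 2))"
    unfolding \<beta>_def by (rule self_intersection_trace_triple[OF assms])
  then obtain X Y where "X \<in> matrix_group \<Gamma>" "trace X = 2 * cos \<beta> * cosh (a / 2)"
    "Y \<in> matrix_group \<Gamma>" "trace Y = 2 * cos \<beta> * cosh ((l - a) / 2)"
    by (auto simp: trace_triple_def)
  with matrix_group_no_elliptic[OF assms(1)]
  have "2 \<le> \<bar>2 * cos \<beta> * cosh (a / 2)\<bar>" "2 \<le> \<bar>2 * cos \<beta> * cosh ((l - a) / 2)\<bar>"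
    by metis+
  \<comment> \<open>Positivity of \<open>cos \<beta>\<close> removes the absolute values, so both
    traces meet the lower bound 2 that the reduction requires.\<close>
  then have loops: "1 \<le> cos \<beta> * cosh (a / 2)" "1 \<le> cos \<beta> * cosh ((l - a) / 2)"
    using pos by (simp_all add: abs_mult cosh_real_nonneg)
  have "2 < commutator_trace (2 * cos \<beta> * cosh (a / 2)) (2 * cos \<beta> * cosh ((l - a) / 2)) (2 * cosh (l / 2))"
    and \<kappa>: "commutator_trace (2 * cos \<beta> * cosh (a / 2)) (2 * cos \<beta> * cosh ((l - a) / 2)) (2 * cosh (l / 2))
      = 2 + 4 * (sinh (l / 2) * sin \<beta>)\<^sup>2"
    using commutator_trace_loops[of \<beta> "a / 2" "(l - a) / 2"] pos l
    by (simp_all add: diff_divide_distrib)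
  then have "18 \<le> 2 + 4 * (sinh (l / 2) * sin \<beta>)\<^sup>2"
    using trace_triple_commutator_trace[OF assms(1) a(3)] loops cosh_real_ge_1[of "l / 2"] by simp
  then have "2\<^sup>2 \<le> (sinh (l / 2) * sin \<beta>)\<^sup>2"
    by simp
  then have "2 \<le> sinh (l / 2) * sin \<beta>"
    using pos l by (intro power2_le_imp_le[of 2]) simp_all
  also have "\<dots> < exp (l / 2) * sin \<beta>"
    using pos by (intro mult_strict_right_mono sinh_less_exp)
  \<comment> \<open>Only the bound 1 instead of 2 is kept from the left side.\<close>
  finally have "exp (- (l / 2)) < sin \<beta>"
    by (simp add: exp_minus field_simps)
  also have "\<dots> \<le> tan \<beta>"
    using pos by (simp add: tan_def field_simps)
  finally have "exp (- (l / 2)) < tan \<beta>" .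
  then have lower: "arctan (exp (- (l / 2))) < \<beta>"
    using tan_\<beta> by (metis arctan_less_iff)
  \<comment> \<open>The shorter loop has length at most \<open>l / 2\<close>, and its trace involves
    half of that length.\<close>
  have "1 \<le> cos \<beta> * cosh (l / 4)"
  proof (cases "a \<le> l / 2")
    case True
    then have "cosh (a / 2) \<le> cosh (l / 4)"
      using a by (subst cosh_real_nonneg_le_iff) auto
    with loops(1) pos show ?thesis
      by (meson mult_left_mono less_imp_le order_trans)
  next
    case False
    then have "cosh ((l - a) / 2) \<le> cosh (l / 4)"
      using a by (subst cosh_real_nonneg_le_iff) auto
    with loops(2) pos show ?thesis
      by (meson mult_left_mono less_imp_le order_trans)
  qed
  then have "1 \<le> (cos \<beta> * cosh (l / 4))\<^sup>2"
    by (simp add: one_le_power)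
  \<comment> \<open>Subtract the squared cosine of \<open>\<beta>\<close> from both sides.\<close>
  then have "(sin \<beta>)\<^sup>2 \<le> (cos \<beta> * sinh (l / 4))\<^sup>2"
    by (simp add: sin_squared_eq power_mult_distrib cosh_square_eq algebra_simps)
  then have "sin \<beta> \<le> cos \<beta> * sinh (l / 4)"
    using pos l by (intro power2_le_imp_le[of "sin \<beta>"]) auto
  also have "\<dots> < cos \<beta> * exp (l / 4)"
    using pos by (intro mult_strict_left_mono sinh_less_exp)
  finally have "tan \<beta> < exp (l / 4)"
    using pos by (simp add: tan_def field_simps)
  then have "\<beta> < arctan (exp (l / 4))"
    using tan_\<beta> by (metis arctan_less_iff)
  \<comment> \<open>Complementary arctangents turn the bound for \<open>\<beta>\<close>, after
    doubling, into \<open>pi - angle_of_parallelism (l / 4)\<close>.\<close>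
  moreover have "arctan (exp (- (l / 4))) = pi / 2 - arctan (exp (l / 4))"
    using arctan_inverse[of "exp (l / 4)"] by (simp add: exp_minus inverse_eq_divide)
  ultimately show ?thesis
    using lower by (simp add: angle_of_parallelism_eq \<beta>_def)
qed

end
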